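(* Let $X$ be a quasi-normed lattice of function sequences and $s\in(0,\infty)$, and assume the regularity $L$ of the Daubechies wavelet system satisfies $L>s$. Then, for any $f\in\Lambda_s$, $$\mathrm{dist}\left(f,\Lambda^s_X\right)_{\Lambda_s}\sim\inf\left\{\varepsilon\in(0,\infty):\left\|\left\{\sum_{I\in W^0_j(s,f,\varepsilon)}\mathbf 1_I\right\}_{j\in\mathbb Z_+}\right\|_X<\infty\right\}$$ with positive equivalence constants independent of $f$, where $W_j^0(s,f,\varepsilon):=\{I\in\mathcal D_j:\max_{\omega\in\Omega:I_\omega=I}|\langle f,\psi_\omega\rangle|>\varepsilon|I|^{s/n+1/2}\}$.
   Context: $\Delta_hf(x):=f(x+h/2)-f(x-h/2)$, $\Delta_h^{k+1}:=\Delta_h^k\Delta_h$, $\Delta_kf(x,y):=\sup_{|h|=y}|\Delta_h^kf(x)|$. $\Lambda_s$ ($s>0$): bounded continuous $f$ with $\|f\|_{\Lambda_s}:=\|f\|_{L^\infty}+\sup_{x\in\mathbb R^n,y\in(0,1]}\Delta_{\lfloor s\rfloor+1}f(x,y)/y^s<\infty$; $\mathrm{dist}(f,V)_{\Lambda_s}:=\inf_{g\in V\cap\Lambda_s}\|f-g\|_{\Lambda_s}$. $\mathcal D_j=\{2^{-j}(k+[0,1)^n):k\in\mathbb Z^n\}$, $\mathcal D=\bigcup_{j\in\mathbb Z_+}\mathcal D_j$. Daubechies wavelet system of regularity $L$: $\varphi,\psi_\ell\in C^L_c(\mathbb R^n)$ ($\ell=1,\dots,2^n-1$), each $\psi_\ell$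 orthogonal to all polynomials of degree $\le L$, with $\{\varphi(\cdot-k)\}_{k}\cup\{2^{jn/2}\psi_\ell(2^j\cdot-k)\}_{\ell,j\ge0,k}$ an orthonormal basis of $L^2$; indexed by $\Omega=\{0\}\times\mathcal D_0\cup\{1,\dots,2^n-1\}\times\mathcal D$ via $\psi_{(0,k+[0,1)^n)}=\varphi(\cdot-k)$, $\psi_{(\ell,2^{-j}(k+[0,1)^n))}=2^{jn/2}\psi_\ell(2^j\cdot-k)$, with $I_{(\ell,I)}:=I$; $\langle f,\psi_\omega\rangle=\int f\psi_\omega$. A quasi-normed lattice of function sequences is a $[0,\infty]$-valued quasi-norm $\|\cdot\|_X$ on sequences $\{f_j\}_{j\in\mathbb Z_+}$ of a.e. finite measurable functions on $\mathbb R^n$, monotone with respect to pointwise a.e. domination of absolute values, with the left and right shifts bounded ($\|\{f_{j+1}\}\|_X+\|\{f_{j-1}\}\|_X\le C\|\{f_j\}\|_X$, $f_{-1}:=0$), and with $\|\{f,0,0,\dots\}\|_X<\infty$ for bounded compactly supported $f$. The Daubechies $s$-Lipschitz $X$-based space $\Lambda^s_X$ is the set of $f\in\Lambda_s$ with $\|\{\sum_{\omega:I_\omega\in\mathcal D_j}|I_\omega|^{-s/n-1/2}|\langle f,\psi_\omega\rangle|\mathbf 1_{I_\omega}\}_{j\in\mathbb Z_+}\|_X<\infty$. *)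

theory Defs
  imports "HOL-Analysis.Analysis"
begin

definition diff1 :: "real^'n \<Rightarrow> (real^'n \<Rightarrow> real) \<Rightarrow> (real^'n \<Rightarrow> real)" where
  "diff1 h f = (\<lambda>x. f (x + (1/2) *\<^sub>R h) - f (x - (1/2) *\<^sub>R h))"

definition diffk :: "nat \<Rightarrow> real^'n \<Rightarrow> (real^'n \<Rightarrow> real) \<Rightarrow> (real^'n \<Rightarrow> real)" where
  "diffk k h f = (diff1 h ^^ k) f"

definition Delta_sup :: "nat \<Rightarrow> (real^'n \<Rightarrow> real) \<Rightarrow> real^'n \<Rightarrow> real \<Rightarrow> ennreal" where
  "Delta_sup k f x y = (SUP h\<in>{h. norm h = y}. ennreal \<bar>diffk k h f x\<bar>)"

text \<open>L^infinity norm (for the continuous functions considered here, the pointwise sup).\<close>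
definition sup_norm :: "(real^'n \<Rightarrow> real) \<Rightarrow> ennreal" where
  "sup_norm f = (SUP x. ennreal \<bar>f x\<bar>)"

definition Lambda_norm :: "real \<Rightarrow> (real^'n \<Rightarrow> real) \<Rightarrow> ennreal" where
  "Lambda_norm s f = sup_norm f +
     (SUP x. SUP y\<in>{0<..1}. Delta_sup (nat \<lfloor>s\<rfloor> + 1) f x y / ennreal (y powr s))"

definition Lambda :: "real \<Rightarrow> (real^'n \<Rightarrow> real) set" where
  "Lambda s = {f. continuous_on UNIV f \<and> bounded (range f) \<and> Lambda_norm s f < \<infinity>}"

definition dist_Lambda :: "real \<Rightarrow> (real^'n \<Rightarrow> real) \<Rightarrow> (real^'n \<Rightarrow> real) set \<Rightarrow> ennreal" where
  "dist_Lambda s f V = (INF g\<in>V \<inter> Lambda s. Lambda_norm s (\<lambda>x. f x - g x))"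

definition ivec :: "int^'n \<Rightarrow> real^'n" where
  "ivec k = (\<chi> i. real_of_int (k $ i))"

definition dcube :: "nat \<Rightarrow> int^'n \<Rightarrow> (real^'n) set" where
  "dcube j k = {x. \<forall>i. real_of_int (k $ i) / 2 ^ j \<le> x $ i \<and> x $ i < (real_of_int (k $ i) + 1) / 2 ^ j}"

definition cube_vol :: "nat \<Rightarrow> int^'n \<Rightarrow> real" where
  "cube_vol j k = measure lborel (dcube j k)"

fun Ck :: "nat \<Rightarrow> (real^'n \<Rightarrow> real) \<Rightarrow> bool" where
  "Ck 0 f = continuous_on UNIV f"
| "Ck (Suc k) f = (f differentiable_on UNIV \<and>
      (\<forall>i. Ck k (\<lambda>x. frechet_derivative f (at x) (axis i 1))))"

definition Ck_c :: "nat \<Rightarrow> (real^'n \<Rightarrow> real) \<Rightarrow> bool" where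
  "Ck_c k f \<longleftrightarrow> Ck k f \<and> compact (closure {x. f x \<noteq> 0})"

text \<open>Index set Omega: (0,0,k) stands for (0, k+[0,1)^n) and (l,j,k), 1 <= l <= 2^n-1,
  stands for (l, 2^{-j}(k+[0,1)^n)).\<close>
definition Omega :: "(nat \<times> nat \<times> (int^'n)) set" where
  "Omega = {(l, j, k). (l = 0 \<and> j = 0) \<or> (1 \<le> l \<and> l \<le> 2 ^ CARD('n) - 1)}"

definition wav :: "(real^'n \<Rightarrow> real) \<Rightarrow> (nat \<Rightarrow> real^'n \<Rightarrow> real)
                   \<Rightarrow> nat \<times> nat \<times> (int^'n) \<Rightarrow> real^'n \<Rightarrow> real" where
  "wav \<phi> \<psi> \<omega> x = (case \<omega> of (l, j, k) \<Rightarrow>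
      if l = 0 then \<phi> (x - ivec k)
      else 2 powr (real j * real CARD('n) / 2) * \<psi> l ((2 ^ j) *\<^sub>R x - ivec k))"

definition daubechies :: "nat \<Rightarrow> (real^'n \<Rightarrow> real) \<Rightarrow> (nat \<Rightarrow> real^'n \<Rightarrow> real) \<Rightarrow> bool" where
  "daubechies L \<phi> \<psi> \<longleftrightarrow>
     Ck_c L \<phi> \<and>
     (\<forall>l\<in>{1..2 ^ CARD('n) - 1}. Ck_c L (\<psi> l)) \<and>
     (\<forall>l\<in>{1..2 ^ CARD('n) - 1}. \<forall>\<alpha>::'n \<Rightarrow> nat. (\<Sum>i\<in>UNIV. \<alpha> i) \<le> L \<longrightarrow>
         (LINT x|lborel. \<psi> l x * (\<Prod>i\<in>UNIV. (x $ i) ^ \<alpha> i)) = 0) \<and>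
     (\<forall>\<omega>\<in>Omega. \<forall>\<omega>'\<in>Omega.
         (LINT x|lborel. wav \<phi> \<psi> \<omega> x * wav \<phi> \<psi> \<omega>' x) = (if \<omega> = \<omega>' then 1 else 0)) \<and>
     (\<forall>g\<in>borel_measurable lborel. integrable lborel (\<lambda>x. (g x)\<^sup>2) \<longrightarrow>
         (\<forall>\<omega>\<in>Omega. (LINT x|lborel. g x * wav \<phi> \<psi> \<omega> x) = 0) \<longrightarrow>
         (AE x in lborel. g x = 0))"

definition coef :: "(real^'n \<Rightarrow> real) \<Rightarrow> (nat \<Rightarrow> real^'n \<Rightarrow> real)
                    \<Rightarrow> (real^'n \<Rightarrow> real) \<Rightarrow> nat \<times> nat \<times> (int^'n) \<Rightarrow> real" where
  "coef \<phi> \<psi> f \<omega> = (LINT x|lborel. f x * wav \<phi> \<psi> \<omega> x)"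

definition adm_seq :: "(nat \<Rightarrow> real^'n \<Rightarrow> real) \<Rightarrow> bool" where
  "adm_seq F \<longleftrightarrow> (\<forall>j. F j \<in> borel_measurable lebesgue)"

definition qn_lattice :: "((nat \<Rightarrow> real^'n \<Rightarrow> real) \<Rightarrow> ennreal) \<Rightarrow> bool" where
  "qn_lattice X \<longleftrightarrow>
     (\<forall>F. adm_seq F \<longrightarrow> (X F = 0 \<longleftrightarrow> (\<forall>j. AE x in lebesgue. F j x = 0))) \<and>
     (\<forall>F c. adm_seq F \<longrightarrow> X (\<lambda>j x. c * F j x) = ennreal \<bar>c\<bar> * X F) \<and>
     (\<exists>K\<ge>1. \<forall>F G. adm_seq F \<longrightarrow> adm_seq G \<longrightarrow>
         X (\<lambda>j x. F j x + G j x) \<le> ennreal K * (X F + X G)) \<and>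
     (\<forall>F G. adm_seq F \<longrightarrow> adm_seq G \<longrightarrow> (\<forall>j. AE x in lebesgue. \<bar>F j x\<bar> \<le> \<bar>G j x\<bar>)
         \<longrightarrow> X F \<le> X G) \<and>
     (\<exists>C. \<forall>F. adm_seq F \<longrightarrow>
         X (\<lambda>j. F (Suc j)) + X (\<lambda>j. if j = 0 then (\<lambda>x. 0) else F (j - 1)) \<le> ennreal C * X F) \<and>
     (\<forall>f. f \<in> borel_measurable lebesgue \<longrightarrow> bounded (range f) \<longrightarrow> bounded {x. f x \<noteq> 0} \<longrightarrow>
         X (\<lambda>j. if j = 0 then f else (\<lambda>x. 0)) < \<infinity>)"

definition wseq :: "real \<Rightarrow> (real^'n \<Rightarrow> real) \<Rightarrow> (nat \<Rightarrow> real^'n \<Rightarrow> real)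
                    \<Rightarrow> (real^'n \<Rightarrow> real) \<Rightarrow> nat \<Rightarrow> real^'n \<Rightarrow> real" where
  "wseq s \<phi> \<psi> f j x = (\<Sum>\<^sub>\<infinity>\<omega>\<in>{\<omega>\<in>Omega. fst (snd \<omega>) = j}.
      cube_vol j (snd (snd \<omega>)) powr (- s / real CARD('n) - 1/2) * \<bar>coef \<phi> \<psi> f \<omega>\<bar>
      * indicator (dcube j (snd (snd \<omega>))) x)"

definition Lambda_X :: "((nat \<Rightarrow> real^'n \<Rightarrow> real) \<Rightarrow> ennreal) \<Rightarrow> real \<Rightarrow> (real^'n \<Rightarrow> real)
                       \<Rightarrow> (nat \<Rightarrow> real^'n \<Rightarrow> real) \<Rightarrow> (real^'n \<Rightarrow> real) set" where
  "Lambda_X X s \<phi> \<psi> = {f \<in> Lambda s. X (wseq s \<phi> \<psi> f) < \<infinity>}"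

text \<open>W^0_j(s,f,eps), cubes in D_j represented by their integer label k.\<close>
definition W0 :: "(real^'n \<Rightarrow> real) \<Rightarrow> (nat \<Rightarrow> real^'n \<Rightarrow> real) \<Rightarrow> real
                  \<Rightarrow> (real^'n \<Rightarrow> real) \<Rightarrow> real \<Rightarrow> nat \<Rightarrow> (int^'n) set" where
  "W0 \<phi> \<psi> s f \<epsilon> j = {k. Max {\<bar>coef \<phi> \<psi> f \<omega>\<bar> | \<omega>. \<omega> \<in> Omega \<and> fst (snd \<omega>) = j \<and> snd (snd \<omega>) = k}
      > \<epsilon> * cube_vol j k powr (s / real CARD('n) + 1/2)}"

definition W0_seq :: "(real^'n \<Rightarrow> real) \<Rightarrow> (nat \<Rightarrow> real^'n \<Rightarrow> real) \<Rightarrow> real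
                  \<Rightarrow> (real^'n \<Rightarrow> real) \<Rightarrow> real \<Rightarrow> nat \<Rightarrow> real^'n \<Rightarrow> real" where
  "W0_seq \<phi> \<psi> s f \<epsilon> j x = (\<Sum>\<^sub>\<infinity>k\<in>W0 \<phi> \<psi> s f \<epsilon> j. indicator (dcube j k) x)"

definition eps_crit :: "((nat \<Rightarrow> real^'n \<Rightarrow> real) \<Rightarrow> ennreal) \<Rightarrow> real \<Rightarrow> (real^'n \<Rightarrow> real)
                       \<Rightarrow> (nat \<Rightarrow> real^'n \<Rightarrow> real) \<Rightarrow> (real^'n \<Rightarrow> real) \<Rightarrow> ennreal" where
  "eps_crit X s \<phi> \<psi> f = Inf {ennreal \<epsilon> | \<epsilon>. 0 < \<epsilon> \<and> X (W0_seq \<phi> \<psi> s f \<epsilon>) < \<infinity>}"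

end

theory Submission
  imports Defs
begin

text \<open>Two facts about the wavelet coefficients \<open>\<langle>f, \<psi>\<^sub>\<omega>\<rangle>\<close> give the result. Analysis: they are
  bounded by \<open>C \<parallel>f\<parallel> |I|\<^bsup>s/n+1/2\<^esup>\<close>. Synthesis: every coefficient family bounded by
  \<open>\<epsilon> |I|\<^bsup>s/n+1/2\<^esup>\<close> is that of a function of norm at most \<open>C \<epsilon>\<close>. If \<open>g\<close> lies in the \<open>X\<close>-based
  space and \<open>\<epsilon> > C \<parallel>f - g\<parallel>\<close>, analysis applied to \<open>f - g\<close> shows that the normalised coefficients
  of \<open>g\<close> stay away from \<open>0\<close> on the cubes of \<open>W\<^sup>0(s, f, \<epsilon>)\<close>, so the indicator sequence of these
  cubes has finite \<open>X\<close>-norm. Conversely, synthesising the coefficients of \<open>f\<close> off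
  \<open>W\<^sup>0(s, f, \<epsilon>)\<close> gives \<open>h\<close> with \<open>\<parallel>h\<parallel> \<le> C \<epsilon>\<close>, and \<open>f - h\<close> lies in the \<open>X\<close>-based space.

  Synthesis is the usual summation over dyadic scales. Analysis avoids Whitney's theorem on local
  polynomial approximation: \<open>\<phi>\<^sup>2\<close> is a \<open>C\<^sup>L\<close> mollifier, of integral \<open>1\<close> by orthonormality, and a
  suitable combination of its dilates reproduces \<open>f\<close> up to an \<open>m\<close>-th difference. Telescoping the
  squares of these averaging operators over the dyadic scales brings the vanishing moments into play.\<close>

section \<open>Functions of class C^k and finite differences\<close>

abbreviation partial :: "'n \<Rightarrow> (real^'n \<Rightarrow> real) \<Rightarrow> real^'n \<Rightarrow> real" where
  "partial i f \<equiv> \<lambda>x. frechet_derivative f (at x) (axis i 1)"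

lemma partial_eqI: "(f has_derivative D) (at x) \<Longrightarrow> partial i f x = D (axis i 1)"
  using frechet_derivative_at[of f D x] by simp

lemma differentiable_on_UNIV_has_derivative:
  "f differentiable_on UNIV \<Longrightarrow> (f has_derivative frechet_derivative f (at x)) (at x)"
  by (simp add: differentiable_on_def frechet_derivative_works)

lemma Ck_SucD: "Ck (Suc k) f \<Longrightarrow> Ck k f"
proof (induction k arbitrary: f)
  case 0
  then show ?case by (simp add: differentiable_imp_continuous_on)
next
  case (Suc k)
  from Suc.prems have "f differentiable_on UNIV \<and> (\<forall>i. Ck (Suc k) (partial i f))"
    by (subst (asm) Ck.simps(2))
  with Suc.IH show ?case by (subst Ck.simps(2)) blast
qed

lemma Ck_antimono: "k \<le> L \<Longrightarrow> Ck L f \<Longrightarrow> Ck k f"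
  by (induction L rule: dec_induct) (auto dest: Ck_SucD simp del: Ck.simps)

lemma Ck_imp_continuous_on: "Ck k f \<Longrightarrow> continuous_on UNIV f"
  using Ck_antimono[of 0 k f] by simp

lemma Ck_const: "Ck k (\<lambda>_. c)"
proof (induction k arbitrary: c)
  case (Suc k)
  have "partial i (\<lambda>_. c) = (\<lambda>_. 0)" for i
    by (rule ext, rule partial_eqI) (rule has_derivative_const)
  with Suc.IH show ?case by simp
qed simp

lemma Ck_add: "Ck k f \<Longrightarrow> Ck k g \<Longrightarrow> Ck k (\<lambda>x. f x + g x)"
proof (induction k arbitrary: f g)
  case 0
  then show ?case by (simp add: continuous_on_add)
next
  case (Suc k)
  have diff: "f differentiable_on UNIV" "g differentiable_on UNIV" using Suc.prems by simp_all
  have "partial i (\<lambda>x. f x + g x) = (\<lambda>x. partial i f x + partial i g x)" for i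
    by (rule ext, rule partial_eqI, intro has_derivative_add)
      (use diff differentiable_on_UNIV_has_derivative in auto)
  with Suc diff show ?case by (simp add: differentiable_on_add)
qed

lemma Ck_mult: "Ck k f \<Longrightarrow> Ck k g \<Longrightarrow> Ck k (\<lambda>x. f x * g x)"
proof (induction k arbitrary: f g)
  case 0
  then show ?case by (simp add: continuous_on_mult)
next
  case (Suc k)
  have diff: "f differentiable_on UNIV" "g differentiable_on UNIV" using Suc.prems by simp_all
  have Leibniz: "partial i (\<lambda>x. f x * g x) = (\<lambda>x. f x * partial i g x + partial i f x * g x)" for i
    by (rule ext, rule partial_eqI, intro has_derivative_mult)
      (use diff differentiable_on_UNIV_has_derivative in auto)
  have "Ck k f" "Ck k g" using Suc.prems Ck_SucD by blast+
  then have "Ck k (\<lambda>x. f x * partial i g x + partial i f x * g x)" for i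
    using Suc by (intro Ck_add Suc.IH) auto
  moreover have "(\<lambda>x. f x * g x) differentiable_on UNIV"
    using diff by (simp add: differentiable_on_def)
  ultimately show ?case by (simp add: Leibniz)
qed

lemma Ck_sum: "finite I \<Longrightarrow> (\<And>i. i \<in> I \<Longrightarrow> Ck k (f i)) \<Longrightarrow> Ck k (\<lambda>x. \<Sum>i\<in>I. f i x)"
  by (induction I rule: finite_induct) (simp_all add: Ck_const Ck_add)

lemma
  assumes "f differentiable_on UNIV"
  shows differentiable_on_affine: "(\<lambda>x. f (a + c *\<^sub>R x)) differentiable_on UNIV"
    and partial_affine: "partial i (\<lambda>x. f (a + c *\<^sub>R x)) = (\<lambda>x. c * partial i f (a + c *\<^sub>R x))"
proof -
  let ?D = "\<lambda>x. frechet_derivative f (at (a + c *\<^sub>R x))"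
  have D: "((\<lambda>x. f (a + c *\<^sub>R x)) has_derivative (\<lambda>v. ?D x (c *\<^sub>R v))) (at x)" for x
  proof (rule has_derivative_compose[of "\<lambda>x. a + c *\<^sub>R x" "\<lambda>v. c *\<^sub>R v"])
    show "((\<lambda>x. a + c *\<^sub>R x) has_derivative (\<lambda>v. c *\<^sub>R v)) (at x)"
      by (auto intro!: derivative_eq_intros)
  qed (rule differentiable_on_UNIV_has_derivative[OF assms])
  then show "(\<lambda>x. f (a + c *\<^sub>R x)) differentiable_on UNIV"
    unfolding differentiable_on_def differentiable_def by blast
  have "linear (?D x)" for x
    using differentiable_on_UNIV_has_derivative[OF assms] by (rule has_derivative_linear)
  then show "partial i (\<lambda>x. f (a + c *\<^sub>R x)) = (\<lambda>x. c * partial i f (a + c *\<^sub>R x))"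
    using partial_eqI[OF D] by (auto simp: linear_cmul)
qed

lemma Ck_affine: "Ck k f \<Longrightarrow> Ck k (\<lambda>x. f (a + c *\<^sub>R x))"
proof (induction k arbitrary: f)
  case 0
  then show ?case by (simp add: continuous_on_compose2[of UNIV f] continuous_intros)
next
  case (Suc k)
  then have diff: "f differentiable_on UNIV" and "\<And>i. Ck k (partial i f)" by simp_all
  then have "Ck k (\<lambda>x. c * partial i f (a + c *\<^sub>R x))" for i
    by (intro Ck_mult Ck_const Suc.IH)
  then show ?case by (simp add: partial_affine[OF diff] differentiable_on_affine[OF diff])
qed

lemma frechet_derivative_eq_sum_partial:
  assumes "f differentiable (at x)"
  shows "frechet_derivative f (at x) v = (\<Sum>i\<in>UNIV. v $ i * partial i f x)"
proof -
  have linear: "linear (frechet_derivative f (at x))"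
    by (rule linear_frechet_derivative[OF assms])
  have "frechet_derivative f (at x) v = frechet_derivative f (at x) (\<Sum>i\<in>UNIV. v $ i *\<^sub>R axis i 1)"
    using basis_expansion[of v] by (simp add: scalar_mult_eq_scaleR)
  also have "\<dots> = (\<Sum>i\<in>UNIV. v $ i * partial i f x)"
    by (simp add: linear_sum[OF linear] linear_cmul[OF linear])
  finally show ?thesis .
qed

lemma has_real_derivative_along_line:
  fixes f :: "real^'n \<Rightarrow> real"
  assumes "f differentiable_on UNIV"
  shows "((\<lambda>t. f (a + t *\<^sub>R v)) has_real_derivative (\<Sum>i\<in>UNIV. v $ i * partial i f (a + t *\<^sub>R v))) (at t)"
proof -
  let ?D = "frechet_derivative f (at (a + t *\<^sub>R v))"
  have "((\<lambda>t. a + t *\<^sub>R v) has_derivative (\<lambda>u. u *\<^sub>R v)) (at t)"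
    by (auto intro!: derivative_eq_intros)
  then have "((\<lambda>t. f (a + t *\<^sub>R v)) has_derivative (\<lambda>u. ?D (u *\<^sub>R v))) (at t)"
    by (rule has_derivative_compose) (rule differentiable_on_UNIV_has_derivative[OF assms])
  moreover have "?D (u *\<^sub>R v) = (\<Sum>i\<in>UNIV. v $ i * partial i f (a + t *\<^sub>R v)) * u" for u
    using assms
    by (subst frechet_derivative_eq_sum_partial)
      (simp_all add: differentiable_on_def sum_distrib_left sum_distrib_right mult_ac)
  ultimately show ?thesis unfolding has_field_derivative_def by simp
qed

fun Ck_bound :: "nat \<Rightarrow> real \<Rightarrow> (real^'n \<Rightarrow> real) \<Rightarrow> bool" where
  "Ck_bound 0 M f = (\<forall>x. \<bar>f x\<bar> \<le> M)"
| "Ck_bound (Suc k) M f = (\<forall>i. Ck_bound k M (partial i f))"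

lemma Ck_bound_mono: "Ck_bound k M f \<Longrightarrow> M \<le> M' \<Longrightarrow> Ck_bound k M' f"
  by (induction k arbitrary: f) (auto intro: order_trans)

text \<open>The \<open>k\<close>-th directional derivative of \<open>f\<close> at \<open>x\<close> along \<open>v\<close>, in a form that shows it to be a
  homogeneous polynomial in \<open>v\<close>.\<close>
fun dir_deriv :: "nat \<Rightarrow> (real^'n \<Rightarrow> real) \<Rightarrow> real^'n \<Rightarrow> real^'n \<Rightarrow> real" where
  "dir_deriv 0 f v x = f x"
| "dir_deriv (Suc k) f v x = (\<Sum>i\<in>UNIV. v $ i * dir_deriv k (partial i f) v x)"

lemma has_real_derivative_dir_deriv:
  "Ck (Suc k) f \<Longrightarrow>
   ((\<lambda>t. dir_deriv k f v (a + t *\<^sub>R v)) has_real_derivative dir_deriv (Suc k) f v (a + t *\<^sub>R v)) (at t)"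
proof (induction k arbitrary: f)
  case 0
  then show ?case using has_real_derivative_along_line[of f a v t] by simp
next
  case (Suc k)
  then have "Ck (Suc k) (partial i f)" for i by simp
  from Suc.IH[OF this] show ?case
    unfolding dir_deriv.simps(2)[of "Suc k"] dir_deriv.simps(2)[of k f]
    by (intro DERIV_sum DERIV_cmult)
qed

lemma abs_sum_component_mult_le:
  fixes v :: "real^'n"
  assumes "\<And>i. \<bar>a i\<bar> \<le> B"
  shows "\<bar>\<Sum>i\<in>UNIV. v $ i * a i\<bar> \<le> real CARD('n) * norm v * B"
proof -
  have "\<bar>\<Sum>i\<in>UNIV. v $ i * a i\<bar> \<le> (\<Sum>i\<in>(UNIV :: 'n set). norm v * B)"
    using assms by (intro order_trans[OF sum_abs] sum_mono)
      (auto simp: abs_mult intro!: mult_mono component_le_norm_cart)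
  then show ?thesis by simp
qed

lemma abs_dir_deriv_le:
  fixes f :: "real^'n \<Rightarrow> real"
  shows "Ck_bound k M f \<Longrightarrow> \<bar>dir_deriv k f v x\<bar> \<le> (real CARD('n) * norm v) ^ k * M"
proof (induction k arbitrary: f)
  case (Suc k)
  then have "\<bar>dir_deriv k (partial i f) v x\<bar> \<le> (real CARD('n) * norm v) ^ k * M" for i by simp
  from abs_sum_component_mult_le[of _ _ v, OF this] show ?case by (simp add: mult_ac)
qed simp

lemma continuous_on_dir_deriv: "continuous_on UNIV (\<lambda>v. dir_deriv k f v x)"
  by (induction k arbitrary: f) (auto intro!: continuous_intros)

lemma abs_taylor_remainder_le:
  fixes f :: "real^'n \<Rightarrow> real"
  assumes "Ck m f" "Ck_bound m M f"
  shows "\<bar>f (a + t *\<^sub>R v) - (\<Sum>k<m. dir_deriv k f v a / fact k * t ^ k)\<bar>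
          \<le> (real CARD('n) * norm v * \<bar>t\<bar>) ^ m * M"
proof -
  have deriv: "DERIV (\<lambda>t. dir_deriv k f v (a + t *\<^sub>R v)) u :> dir_deriv (Suc k) f v (a + u *\<^sub>R v)"
    if "k < m" for k u
    using has_real_derivative_dir_deriv Ck_antimono[OF _ assms(1)] that by (metis Suc_leI)
  obtain u where u: "f (a + t *\<^sub>R v) = (\<Sum>k<m. dir_deriv k f v (a + 0 *\<^sub>R v) / fact k * t ^ k)
      + dir_deriv m f v (a + u *\<^sub>R v) / fact m * t ^ m"
    using Maclaurin_bi_le[of "\<lambda>k t. dir_deriv k f v (a + t *\<^sub>R v)" "\<lambda>t. f (a + t *\<^sub>R v)" m t] deriv
    by auto
  let ?d = "dir_deriv m f v (a + u *\<^sub>R v)"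
  have "\<bar>?d\<bar> / fact m \<le> \<bar>?d\<bar> / 1" by (rule divide_left_mono) (auto simp: fact_ge_1)
  also have "\<dots> \<le> (real CARD('n) * norm v) ^ m * M" using abs_dir_deriv_le[OF assms(2)] by simp
  finally have "\<bar>?d\<bar> / fact m * \<bar>t\<bar> ^ m \<le> (real CARD('n) * norm v) ^ m * M * \<bar>t\<bar> ^ m"
    by (rule mult_right_mono) simp
  with u show ?thesis by (simp add: abs_mult power_abs power_mult_distrib mult_ac)
qed

lemma diffk_Suc: "diffk (Suc k) h f x = diffk k h f (x + (1/2) *\<^sub>R h) - diffk k h f (x - (1/2) *\<^sub>R h)"
  by (simp add: diffk_def diff1_def)

lemma diffk_Suc_right: "diffk (Suc k) h f = diffk k h (diff1 h f)"
  by (simp add: diffk_def funpow_swap1)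

lemma diffk_0 [simp]: "diffk 0 h f = f"
  by (simp add: diffk_def)

lemma diffk_zero_step: "diffk (Suc k) 0 f x = 0"
  by (simp add: diffk_Suc)

lemma diffk_scaleR: "diffk k h (\<lambda>x. f (c *\<^sub>R x)) x = diffk k (c *\<^sub>R h) f (c *\<^sub>R x)"
  by (induction k arbitrary: x) (simp_all add: diffk_Suc scaleR_add_right scaleR_diff_right)

lemma diffk_diff: "diffk k h (\<lambda>x. f x - g x) x = diffk k h f x - diffk k h g x"
  by (induction k arbitrary: x) (simp_all add: diffk_Suc)

lemma diffk_sum: "diffk k h (\<lambda>x. \<Sum>l\<in>A. f l x) x = (\<Sum>l\<in>A. diffk k h (f l) x)"
  by (induction k arbitrary: x) (simp_all add: diffk_Suc sum_subtractf)

lemma diffk_sums: "(\<And>x. (\<lambda>j. g j x) sums f x) \<Longrightarrow> (\<lambda>j. diffk k h (g j) x) sums diffk k h f x"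
  by (induction k arbitrary: x) (simp_all add: diffk_Suc sums_diff)

lemma abs_diffk_le: "(\<And>x. \<bar>f x\<bar> \<le> M) \<Longrightarrow> \<bar>diffk k h f x\<bar> \<le> 2 ^ k * M"
proof (induction k arbitrary: x)
  case (Suc k)
  have "\<bar>diffk (Suc k) h f x\<bar> \<le> 2 ^ k * M + 2 ^ k * M"
    unfolding diffk_Suc using Suc.IH[OF Suc.prems] by (intro order_trans[OF abs_triangle_ineq4] add_mono)
  then show ?case by (simp add: mult_ac)
qed simp

lemma
  assumes "f differentiable_on UNIV"
  shows differentiable_on_diff1: "diff1 h f differentiable_on UNIV"
    and partial_diff1: "partial i (diff1 h f) = diff1 h (partial i f)"
proof -
  let ?shift = "\<lambda>a x. f (a + 1 *\<^sub>R x)"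
  have diff1: "diff1 h f = (\<lambda>x. ?shift ((1/2) *\<^sub>R h) x - ?shift (- (1/2) *\<^sub>R h) x)"
    by (simp add: diff1_def add.commute)
  have shift: "?shift a differentiable_on UNIV" for a by (rule differentiable_on_affine[OF assms])
  then show "diff1 h f differentiable_on UNIV"
    unfolding diff1 by (intro differentiable_on_diff)
  have "partial i f (a + x) = partial i (?shift a) x" for a x
    using fun_cong[OF partial_affine[OF assms, where a = a and c = 1], of x] by simp
  then have "partial i (diff1 h f) x = partial i f ((1/2) *\<^sub>R h + x) - partial i f (- (1/2) *\<^sub>R h + x)"
    for x
    unfolding diff1
    by (simp only:)
      (rule partial_eqI, intro has_derivative_diff differentiable_on_UNIV_has_derivative shift)
  then show "partial i (diff1 h f) = diff1 h (partial i f)"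
    by (simp add: diff1_def fun_eq_iff add.commute)
qed

lemma abs_diff1_le:
  fixes f :: "real^'n \<Rightarrow> real"
  assumes "f differentiable_on UNIV" "\<And>i x. \<bar>partial i f x\<bar> \<le> M"
  shows "\<bar>diff1 h f x\<bar> \<le> real CARD('n) * norm h * M"
proof -
  let ?a = "x - (1/2) *\<^sub>R h"
  have "\<exists>z>0. z < 1 \<and> f (?a + 1 *\<^sub>R h) - f (?a + 0 *\<^sub>R h)
      = (1 - 0) * (\<Sum>i\<in>UNIV. h $ i * partial i f (?a + z *\<^sub>R h))"
    by (rule MVT2) (use has_real_derivative_along_line[OF assms(1)] in auto)
  then obtain z where "f (?a + h) - f ?a = (\<Sum>i\<in>UNIV. h $ i * partial i f (?a + z *\<^sub>R h))" by auto
  moreover have "?a + h = x + (1/2) *\<^sub>R h" by (simp add: vec_eq_iff)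
  ultimately have "diff1 h f x = (\<Sum>i\<in>UNIV. h $ i * partial i f (?a + z *\<^sub>R h))" by (simp add: diff1_def)
  then show ?thesis
    using abs_sum_component_mult_le[of "\<lambda>i. partial i f (?a + z *\<^sub>R h)" M h] assms(2) by simp
qed

lemma Ck_diff1:
  fixes f :: "real^'n \<Rightarrow> real"
  shows "Ck (Suc k) f \<Longrightarrow> Ck_bound (Suc k) M f \<Longrightarrow>
    Ck k (diff1 h f) \<and> Ck_bound k (real CARD('n) * norm h * M) (diff1 h f)"
proof (induction k arbitrary: f)
  case 0
  then show ?case
    by (simp add: differentiable_imp_continuous_on differentiable_on_diff1 abs_diff1_le)
next
  case (Suc k)
  then have diff: "f differentiable_on UNIV"
    and "\<And>i. Ck (Suc k) (partial i f)" "\<And>i. Ck_bound (Suc k) M (partial i f)"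
    by simp_all
  with Suc.IH show ?case by (simp add: differentiable_on_diff1[OF diff] partial_diff1[OF diff])
qed

lemma abs_diffk_le_Ck_bound:
  fixes f :: "real^'n \<Rightarrow> real"
  shows "Ck k f \<Longrightarrow> Ck_bound k M f \<Longrightarrow> \<bar>diffk k h f x\<bar> \<le> (real CARD('n) * norm h) ^ k * M"
proof (induction k arbitrary: f M)
  case (Suc k)
  from Suc.IH Ck_diff1[OF Suc.prems]
  have "\<bar>diffk k h (diff1 h f) x\<bar> \<le> (real CARD('n) * norm h) ^ k * (real CARD('n) * norm h * M)" by blast
  then show ?case by (simp only: diffk_Suc_right power_Suc mult_ac)
qed simp

lemma diffk_eq_sum_binomial:
  "diffk k h f x = (\<Sum>r\<le>k. (-1) ^ (k + r) * real (k choose r) * f (x + (real r - real k / 2) *\<^sub>R h))"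
proof (induction k arbitrary: x)
  case (Suc k)
  define F where "F r = f (x + (real r - real (Suc k) / 2) *\<^sub>R h)" for r
  have right: "x + (1/2) *\<^sub>R h + (real r - real k / 2) *\<^sub>R h
      = x + (real (Suc r) - real (Suc k) / 2) *\<^sub>R h"
    and left: "x - (1/2) *\<^sub>R h + (real r - real k / 2) *\<^sub>R h
      = x + (real r - real (Suc k) / 2) *\<^sub>R h" for r
    by (simp_all add: vec_eq_iff field_simps)
  have "diffk (Suc k) h f x = (\<Sum>r\<le>k. (-1) ^ (k + r) * real (k choose r) * F (Suc r))
      - (\<Sum>r\<le>k. (-1) ^ (k + r) * real (k choose r) * F r)"
    unfolding diffk_Suc Suc.IH right left F_def ..
  also have "(\<Sum>r\<le>k. (-1) ^ (k + r) * real (k choose r) * F r)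
      = (\<Sum>r\<le>Suc k. (-1) ^ (k + r) * real (k choose r) * F r)" by simp
  also have "\<dots> = (-1) ^ k * F 0 + (\<Sum>r\<le>k. (-1) ^ (k + Suc r) * real (k choose Suc r) * F (Suc r))"
    by (subst sum.atMost_Suc_shift) simp
  also have "(\<Sum>r\<le>k. (-1) ^ (k + r) * real (k choose r) * F (Suc r)) -
      ((-1) ^ k * F 0 + (\<Sum>r\<le>k. (-1) ^ (k + Suc r) * real (k choose Suc r) * F (Suc r)))
      = (-1) ^ (Suc k) * F 0 + (\<Sum>r\<le>k. (-1) ^ (Suc k + Suc r) * real (Suc k choose Suc r) * F (Suc r))"
    by (simp add: sum.distrib algebra_simps sum_negf)
  also have "\<dots> = (\<Sum>r\<le>Suc k. (-1) ^ (Suc k + r) * real (Suc k choose r) * F r)"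
    by (subst sum.atMost_Suc_shift) simp
  finally show ?case unfolding F_def .
qed simp

section \<open>Compactly supported functions\<close>

definition vanishes_outside :: "real \<Rightarrow> ('a::real_normed_vector \<Rightarrow> 'b::zero) \<Rightarrow> bool" where
  "vanishes_outside R f \<longleftrightarrow> (\<forall>x. R < norm x \<longrightarrow> f x = 0)"

lemma vanishes_outsideD: "vanishes_outside R f \<Longrightarrow> R < norm x \<Longrightarrow> f x = 0"
  by (simp add: vanishes_outside_def)

lemma vanishes_outside_mono: "vanishes_outside R f \<Longrightarrow> R \<le> S \<Longrightarrow> vanishes_outside S f"
  by (simp add: vanishes_outside_def)

lemma vanishes_outside_mult:
  fixes f g :: "'a::real_normed_vector \<Rightarrow> 'b::mult_zero"
  shows "vanishes_outside R f \<Longrightarrow> vanishes_outside R (\<lambda>x. g x * f x)"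
  by (simp add: vanishes_outside_def)

lemma vanishes_outside_partial:
  assumes "vanishes_outside R f"
  shows "vanishes_outside R (partial i f)"
  unfolding vanishes_outside_def
proof (intro allI impI)
  fix x :: "real^'a" assume "R < norm x"
  have "((\<lambda>_. 0) has_derivative (\<lambda>_. 0)) (at x)" by simp
  moreover have "open {x::real^'a. R < norm x}"
    by (intro open_Collect_less continuous_intros)
  ultimately have "(f has_derivative (\<lambda>_. 0)) (at x)"
    by (rule has_derivative_transform_within_open)
      (use \<open>R < norm x\<close> vanishes_outsideD[OF assms] in auto)
  from partial_eqI[OF this] show "partial i f x = 0" by simp
qed

lemma vanishes_outside_diff1:
  assumes "vanishes_outside R f"
  shows "vanishes_outside (R + norm h / 2) (diff1 h f)"
  unfolding vanishes_outside_def
proof (intro allI impI)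
  fix x :: "real^'a" assume "R + norm h / 2 < norm x"
  then have "R < norm (x + (1/2) *\<^sub>R h)" "R < norm (x - (1/2) *\<^sub>R h)"
    using norm_triangle_ineq2[of x "(1/2) *\<^sub>R h"] norm_diff_ineq[of x "(1/2) *\<^sub>R h"] by simp_all
  then show "diff1 h f x = 0" using vanishes_outsideD[OF assms] by (simp add: diff1_def)
qed

lemma vanishes_outside_diffk:
  "vanishes_outside R f \<Longrightarrow> vanishes_outside (R + real k * (norm h / 2)) (diffk k h f)"
proof (induction k arbitrary: f R)
  case (Suc k)
  have radius: "R + real (Suc k) * (norm h / 2) = R + norm h / 2 + real k * (norm h / 2)"
    by (simp add: field_simps)
  show ?case
    unfolding radius diffk_Suc_right by (rule Suc.IH[OF vanishes_outside_diff1[OF Suc.prems]])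
qed simp

lemma bounded_range_if_vanishes_outside:
  fixes f :: "'a::euclidean_space \<Rightarrow> 'b::real_normed_vector"
  assumes "continuous_on UNIV f" "vanishes_outside R f"
  shows "bounded (range f)"
proof -
  have "compact (f ` cball 0 R)"
    by (rule compact_continuous_image) (use continuous_on_subset[OF assms(1)] in auto)
  then have "bounded (insert 0 (f ` cball 0 R))" by (simp add: compact_imp_bounded)
  moreover have "range f \<subseteq> insert 0 (f ` cball 0 R)"
    using vanishes_outsideD[OF assms(2)] by (force simp: not_le)
  ultimately show ?thesis by (rule bounded_subset)
qed

lemma ex_Ck_bound_if_vanishes_outside:
  "Ck k f \<Longrightarrow> vanishes_outside R f \<Longrightarrow> \<exists>M. Ck_bound k M f"
proof (induction k arbitrary: f)
  case 0
  then show ?case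
    using bounded_range_if_vanishes_outside[of f R] by (auto simp: bounded_iff)
next
  case (Suc k)
  have "\<exists>M. Ck_bound k M (partial i f)" for i
    by (rule Suc.IH) (use Suc.prems vanishes_outside_partial in auto)
  then obtain M where "Ck_bound k (M i) (partial i f)" for i by metis
  then have "Ck_bound k (Max (range M)) (partial i f)" for i by (rule Ck_bound_mono) simp
  then show ?case by auto
qed

lemma integrable_if_vanishes_outside:
  fixes f :: "'a::euclidean_space \<Rightarrow> real"
  assumes "continuous_on UNIV f" "vanishes_outside R f"
  shows "integrable lborel f"
proof -
  have "integrable lborel (\<lambda>x. indicator (cball 0 R) x *\<^sub>R f x)"
    by (rule borel_integrable_compact) (use continuous_on_subset[OF assms(1)] in auto)
  moreover have "(\<lambda>x. indicator (cball 0 R) x *\<^sub>R f x) = f"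
    using vanishes_outsideD[OF assms(2)] by (auto simp: fun_eq_iff indicator_def not_le)
  ultimately show ?thesis by simp
qed

locale bump =
  fixes k :: nat and R M :: real and f :: "real^'n \<Rightarrow> real"
  assumes smooth: "Ck k f"
    and vanishes: "vanishes_outside R f"
    and bound: "\<bar>f x\<bar> \<le> M"
    and deriv_bound: "Ck_bound k M f"
    and L1_bound: "(LINT x|lborel. \<bar>f x\<bar>) \<le> M"
    and radius_pos: "0 < R"
    and bound_pos: "0 < M"
begin

lemma continuous: "continuous_on UNIV f"
  by (rule Ck_imp_continuous_on[OF smooth])

lemma measurable: "f \<in> borel_measurable borel"
  by (rule borel_measurable_continuous_onI[OF continuous])

lemma integrable: "integrable lborel f"
  by (rule integrable_if_vanishes_outside[OF continuous vanishes])

end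

lemma bump_mono:
  assumes "bump k R M f" "R \<le> R'" "M \<le> M'"
  shows "bump k R' M' f"
proof -
  interpret bump k R M f by fact
  show ?thesis
    using assms(2,3) smooth vanishes bound deriv_bound L1_bound radius_pos bound_pos
    by unfold_locales (auto intro: vanishes_outside_mono Ck_bound_mono order_trans)
qed

lemma ex_bump:
  assumes "Ck k f" "vanishes_outside R f"
  shows "\<exists>R M. bump k R M f"
proof -
  obtain N where N: "\<And>x. \<bar>f x\<bar> \<le> N"
    using bounded_range_if_vanishes_outside[OF Ck_imp_continuous_on[OF assms(1)] assms(2)]
    by (auto simp: bounded_iff)
  obtain N' where N': "Ck_bound k N' f" using ex_Ck_bound_if_vanishes_outside assms by blast
  let ?M = "1 + \<bar>N\<bar> + \<bar>N'\<bar> + (LINT x|lborel. \<bar>f x\<bar>)"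
  have L1_nonneg: "0 \<le> (LINT x|lborel. \<bar>f x\<bar>)" by simp
  have "bump k (max R 1) ?M f"
  proof
    show "\<bar>f x\<bar> \<le> ?M" for x using N[of x] L1_nonneg by linarith
    show "Ck_bound k ?M f" by (rule Ck_bound_mono[OF N']) (use L1_nonneg in linarith)
    show "0 < ?M" using L1_nonneg by linarith
  qed (use assms in \<open>auto intro: vanishes_outside_mono\<close>)
  then show ?thesis by blast
qed

lemma ex_common_bump:
  "finite I \<Longrightarrow> (\<And>i. i \<in> I \<Longrightarrow> \<exists>R M. bump k R M (f i)) \<Longrightarrow> \<exists>R M. \<forall>i\<in>I. bump k R M (f i)"
proof (induction I rule: finite_induct)
  case (insert i I)
  then obtain R M R' M' where "\<forall>i\<in>I. bump k R M (f i)" "bump k R' M' (f i)" by (metis insertCI)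
  then have "\<forall>j\<in>insert i I. bump k (max R R') (max M M') (f j)"
    by (auto intro: bump_mono)
  then show ?case by blast
qed simp

lemma ex_bump_if_Ck_c:
  assumes "Ck_c L f" "k \<le> L"
  shows "\<exists>R M. bump k R M f"
proof -
  have "bounded {x. f x \<noteq> 0}"
    using assms(1) unfolding Ck_c_def by (meson bounded_subset closure_subset compact_imp_bounded)
  then obtain R where "vanishes_outside R f"
    unfolding bounded_iff vanishes_outside_def by (metis leD mem_Collect_eq)
  then show ?thesis using assms Ck_antimono ex_bump unfolding Ck_c_def by blast
qed

section \<open>Averages against a kernel\<close>

lemma lborel_integral_affine:
  fixes F :: "'a::euclidean_space \<Rightarrow> real"
  assumes [measurable]: "F \<in> borel_measurable borel" and "c \<noteq> 0"
  shows "(LINT x|lborel. F x) = \<bar>c\<bar> ^ DIM('a) * (LINT x|lborel. F (t + c *\<^sub>R x))"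
  by (subst lborel_affine[OF assms(2), of t])
    (simp add: integral_density integral_distr)

definition bounded_borel :: "real \<Rightarrow> ('a::topological_space \<Rightarrow> real) \<Rightarrow> bool" where
  "bounded_borel G g \<longleftrightarrow> g \<in> borel_measurable borel \<and> (\<forall>x. \<bar>g x\<bar> \<le> G)"

lemma bounded_borel_measurable: "bounded_borel G g \<Longrightarrow> g \<in> borel_measurable borel"
  and bounded_borelD: "bounded_borel G g \<Longrightarrow> \<bar>g x\<bar> \<le> G"
  by (simp_all add: bounded_borel_def)

lemma bounded_borel_nonneg: "bounded_borel G g \<Longrightarrow> 0 \<le> G"
  using bounded_borelD abs_ge_zero order_trans by blast

lemma bounded_borel_affine:
  fixes g :: "'a::euclidean_space \<Rightarrow> real"
  assumes "bounded_borel G g"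
  shows "bounded_borel G (\<lambda>x. g (a + c *\<^sub>R x))"
proof -
  have [measurable]: "g \<in> borel_measurable borel" by (rule bounded_borel_measurable[OF assms])
  show ?thesis using bounded_borelD[OF assms] by (simp add: bounded_borel_def)
qed

lemma
  fixes w :: "'a::euclidean_space \<Rightarrow> real"
  assumes g: "bounded_borel G g" and w: "integrable lborel w"
  shows integrable_bounded_borel_mult: "integrable lborel (\<lambda>x. g x * w x)"
    and abs_integral_bounded_borel_mult_le:
      "\<bar>LINT x|lborel. g x * w x\<bar> \<le> G * (LINT x|lborel. \<bar>w x\<bar>)"
proof -
  have [measurable]: "g \<in> borel_measurable borel" "w \<in> borel_measurable borel"
    using bounded_borel_measurable[OF g] w by auto
  have pointwise: "\<bar>g x * w x\<bar> \<le> G * \<bar>w x\<bar>" for x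
    unfolding abs_mult using bounded_borelD[OF g] by (intro mult_right_mono) auto
  have majorant: "integrable lborel (\<lambda>x. G * \<bar>w x\<bar>)" using w by simp
  show integrable: "integrable lborel (\<lambda>x. g x * w x)"
    by (rule Bochner_Integration.integrable_bound[OF majorant])
      (use pointwise bounded_borel_nonneg[OF g] in \<open>auto simp: abs_mult\<close>)
  have "\<bar>LINT x|lborel. g x * w x\<bar> \<le> (LINT x|lborel. \<bar>g x * w x\<bar>)" by (rule integral_abs_bound)
  also have "\<dots> \<le> (LINT x|lborel. G * \<bar>w x\<bar>)"
    using integrable majorant pointwise by (intro integral_mono) auto
  finally show "\<bar>LINT x|lborel. g x * w x\<bar> \<le> G * (LINT x|lborel. \<bar>w x\<bar>)" by simp
qed

lemma sums_integral_bounded_borel_mult: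
  fixes w :: "'a::euclidean_space \<Rightarrow> real"
  assumes g: "\<And>j. bounded_borel (G j) (g j)" and G: "summable G" and w: "integrable lborel w"
  shows "(\<lambda>j. LINT x|lborel. g j x * w x) sums (LINT x|lborel. (\<Sum>j. g j x) * w x)"
proof -
  have summable: "summable (\<lambda>j. \<bar>g j x\<bar>)" for x
    by (rule summable_comparison_test'[OF G, of 0]) (use bounded_borelD[OF g] in auto)
  have "bounded_borel (G j) (\<lambda>x. \<bar>g j x\<bar>)" for j
    using g[of j] by (auto simp: bounded_borel_def)
  from abs_integral_bounded_borel_mult_le[OF this integrable_abs[OF w]]
  have norm_le: "(LINT x|lborel. norm (g j x * w x)) \<le> G j * (LINT x|lborel. \<bar>w x\<bar>)" for j
    by (simp add: abs_mult)
  have "(\<lambda>j. LINT x|lborel. g j x * w x) sums (LINT x|lborel. (\<Sum>j. g j x * w x))"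
  proof (rule sums_integral[OF integrable_bounded_borel_mult[OF g w]])
    show "AE x in lborel. summable (\<lambda>j. norm (g j x * w x))"
      using summable by (auto simp: abs_mult intro!: summable_mult2)
    show "summable (\<lambda>j. LINT x|lborel. norm (g j x * w x))"
      by (rule summable_comparison_test'[OF summable_mult2[OF G], of 0]) (use norm_le in auto)
  qed
  then show ?thesis by (simp add: suminf_mult2[OF summable_rabs_cancel[OF summable]])
qed

lemma Fubini_bounded_borel_mult:
  fixes F :: "'a::euclidean_space \<Rightarrow> 'b::euclidean_space \<Rightarrow> real"
  assumes F: "bounded_borel G (\<lambda>(x, y). F x y)"
    and v: "integrable lborel v" and w: "integrable lborel w"
  shows "(LINT x|lborel. LINT y|lborel. F x y * (v x * w y))
       = (LINT y|lborel. LINT x|lborel. F x y * (v x * w y))"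
proof (rule lborel_pair.Fubini_integral[symmetric])
  have [measurable]: "v \<in> borel_measurable borel" "w \<in> borel_measurable borel" using v w by auto
  have [measurable]: "(\<lambda>(x, y). F x y) \<in> borel_measurable (borel \<Otimes>\<^sub>M borel)"
    using bounded_borel_measurable[OF F] by (simp add: borel_prod)
  have product: "integrable (lborel \<Otimes>\<^sub>M lborel) (\<lambda>(x, y). v x * w y)"
  proof (rule lborel_pair.Fubini_integrable)
    show "integrable lborel (\<lambda>x. LINT y|lborel. norm (case (x, y) of (x, y) \<Rightarrow> v x * w y))"
      using v by (simp add: abs_mult)
  qed (use w in auto)
  show "integrable (lborel \<Otimes>\<^sub>M lborel) (\<lambda>(x, y). F x y * (v x * w y))"
  proof (rule Bochner_Integration.integrable_bound)
    show "integrable (lborel \<Otimes>\<^sub>M lborel) (\<lambda>p. G * (case p of (x, y) \<Rightarrow> v x * w y))"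
      using product by (rule integrable_mult_right)
    show "AE p in lborel \<Otimes>\<^sub>M lborel. norm (case p of (x, y) \<Rightarrow> F x y * (v x * w y))
        \<le> norm (G * (case p of (x, y) \<Rightarrow> v x * w y))"
      using bounded_borelD[OF F] bounded_borel_nonneg[OF F]
      by (intro AE_I2) (auto simp: abs_mult intro!: mult_right_mono)
  qed measurable
qed

definition kernel_avg :: "('a::euclidean_space \<Rightarrow> real) \<Rightarrow> real \<Rightarrow> ('a \<Rightarrow> real) \<Rightarrow> 'a \<Rightarrow> real" where
  "kernel_avg w t g x = (LINT u|lborel. g (x + t *\<^sub>R u) * w u)"

lemma integrable_kernel_avg:
  "bounded_borel G g \<Longrightarrow> integrable lborel w \<Longrightarrow> integrable lborel (\<lambda>u. g (x + t *\<^sub>R u) * w u)"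
  by (rule integrable_bounded_borel_mult[OF bounded_borel_affine])

lemma kernel_avg_diff:
  assumes "bounded_borel G g" "bounded_borel H h" "integrable lborel w"
  shows "kernel_avg w t (\<lambda>x. g x - h x) x = kernel_avg w t g x - kernel_avg w t h x"
  using integrable_kernel_avg[OF assms(1,3)] integrable_kernel_avg[OF assms(2,3)]
  by (simp add: kernel_avg_def left_diff_distrib)

lemma kernel_avg_add:
  assumes "bounded_borel G g" "bounded_borel H h" "integrable lborel w"
  shows "kernel_avg w t (\<lambda>x. g x + h x) x = kernel_avg w t g x + kernel_avg w t h x"
  using integrable_kernel_avg[OF assms(1,3)] integrable_kernel_avg[OF assms(2,3)]
  by (simp add: kernel_avg_def distrib_right)

lemma (in bump) abs_kernel_avg_le:
  assumes g: "bounded_borel G g"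
  shows "\<bar>kernel_avg f t g x\<bar> \<le> G * M"
proof -
  have "\<bar>kernel_avg f t g x\<bar> \<le> G * (LINT u|lborel. \<bar>f u\<bar>)"
    unfolding kernel_avg_def
    by (rule abs_integral_bounded_borel_mult_le[OF bounded_borel_affine[OF g] integrable])
  also have "\<dots> \<le> G * M" by (rule mult_left_mono[OF L1_bound bounded_borel_nonneg[OF g]])
  finally show ?thesis .
qed

lemma (in bump) bounded_borel_kernel_avg:
  assumes g: "bounded_borel G g"
  shows "bounded_borel (G * M) (kernel_avg f t g)"
proof -
  have [measurable]: "g \<in> borel_measurable borel" "f \<in> borel_measurable borel"
    using bounded_borel_measurable[OF g] measurable by auto
  have "kernel_avg f t g \<in> borel_measurable borel"
    unfolding kernel_avg_def by measurable
  then show ?thesis using abs_kernel_avg_le[OF g] by (simp add: bounded_borel_def)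
qed

lemma kernel_avg_commute:
  fixes v w g :: "'a::euclidean_space \<Rightarrow> real"
  assumes g: "bounded_borel G g" and v: "integrable lborel v" and w: "integrable lborel w"
  shows "kernel_avg v s (kernel_avg w t g) x = kernel_avg w t (kernel_avg v s g) x"
proof -
  let ?F = "\<lambda>p q. g (x + s *\<^sub>R p + t *\<^sub>R q)"
  have [measurable]: "g \<in> borel_measurable borel" by (rule bounded_borel_measurable[OF g])
  have "kernel_avg v s (kernel_avg w t g) x = (LINT p|lborel. LINT q|lborel. ?F p q * (v p * w q))"
    by (simp add: kernel_avg_def mult_ac flip: integral_mult_left_zero)
  also have "\<dots> = (LINT q|lborel. LINT p|lborel. ?F p q * (v p * w q))"
  proof (rule Fubini_bounded_borel_mult[OF _ v w])
    have "(\<lambda>(p, q). ?F p q) \<in> borel_measurable (borel \<Otimes>\<^sub>M borel)" by measurable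
    then show "bounded_borel G (\<lambda>(p, q). ?F p q)"
      using bounded_borelD[OF g] by (simp add: bounded_borel_def borel_prod)
  qed
  also have "\<dots> = kernel_avg w t (kernel_avg v s g) x"
    by (simp add: kernel_avg_def add_ac mult.assoc flip: integral_mult_left_zero)
  finally show ?thesis .
qed

section \<open>Vanishing moments\<close>

definition vanishing_moments :: "nat \<Rightarrow> (real^'n \<Rightarrow> real) \<Rightarrow> bool" where
  "vanishing_moments L w \<longleftrightarrow> (\<forall>\<alpha>::'n \<Rightarrow> nat. (\<Sum>i\<in>UNIV. \<alpha> i) \<le> L \<longrightarrow>
     (LINT x|lborel. w x * (\<Prod>i\<in>UNIV. (x $ i) ^ \<alpha> i)) = 0)"

lemma (in bump) integrable_continuous_mult:
  "continuous_on UNIV g \<Longrightarrow> integrable lborel (\<lambda>x. g x * f x)"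
  by (intro integrable_if_vanishes_outside[of _ R] continuous_intros continuous
      vanishes_outside_mult vanishes)

lemma (in bump) integral_monomial_dir_deriv_eq_0:
  assumes moments: "vanishing_moments L f"
  shows "(\<Sum>i\<in>UNIV. \<alpha> i) + q \<le> L \<Longrightarrow>
    (LINT z|lborel. dir_deriv q \<eta> z x * (\<Prod>i\<in>UNIV. (z $ i) ^ \<alpha> i) * f z) = 0"
proof (induction q arbitrary: \<eta> \<alpha>)
  case 0
  then show ?case
    using moments by (simp add: vanishing_moments_def mult.assoc mult.commute[of "f _"])
next
  case (Suc q)
  let ?\<beta> = "\<lambda>i. \<alpha>(i := Suc (\<alpha> i))"
  have raise: "(\<Prod>j\<in>UNIV. (z $ j) ^ ?\<beta> i j) = z $ i * (\<Prod>j\<in>UNIV. (z $ j) ^ \<alpha> j)" for i and z :: "real^'n"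
  proof -
    have "(\<Prod>j\<in>UNIV. (z $ j) ^ ?\<beta> i j) = (\<Prod>j\<in>UNIV. (if j = i then z $ j else 1) * (z $ j) ^ \<alpha> j)"
      by (rule prod.cong) auto
    then show ?thesis by (simp add: prod.distrib)
  qed
  have "(\<Sum>j\<in>UNIV. ?\<beta> i j) = (\<Sum>j\<in>UNIV. \<alpha> j + (if j = i then 1 else 0))" for i
    by (rule sum.cong) auto
  then have degree: "(\<Sum>j\<in>UNIV. ?\<beta> i j) + q \<le> L" for i using Suc.prems by (simp add: sum.distrib)
  have "(LINT z|lborel. dir_deriv (Suc q) \<eta> z x * (\<Prod>i\<in>UNIV. (z $ i) ^ \<alpha> i) * f z)
      = (LINT z|lborel. (\<Sum>i\<in>UNIV.
          dir_deriv q (partial i \<eta>) z x * (\<Prod>j\<in>UNIV. (z $ j) ^ ?\<beta> i j) * f z))"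
    unfolding raise dir_deriv.simps by (simp add: sum_distrib_left sum_distrib_right mult_ac)
  also have "\<dots> = (\<Sum>i\<in>UNIV. LINT z|lborel.
      dir_deriv q (partial i \<eta>) z x * (\<Prod>j\<in>UNIV. (z $ j) ^ ?\<beta> i j) * f z)"
    by (intro Bochner_Integration.integral_sum integrable_continuous_mult continuous_intros
        continuous_on_dir_deriv)
  also have "\<dots> = 0" using Suc.IH[OF degree] by simp
  finally show ?case .
qed

lemma (in bump) integral_taylor_polynomial_eq_0:
  assumes "vanishing_moments L f" "m \<le> Suc L"
  shows "(LINT z|lborel. (\<Sum>q<m. dir_deriv q \<eta> z x / fact q * t ^ q) * f z) = 0"
proof -
  have "(LINT z|lborel. (\<Sum>q<m. dir_deriv q \<eta> z x / fact q * t ^ q) * f z)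
      = (\<Sum>q<m. LINT z|lborel. (dir_deriv q \<eta> z x / fact q * t ^ q) * f z)"
    unfolding sum_distrib_right
    by (intro Bochner_Integration.integral_sum integrable_continuous_mult continuous_intros
        continuous_on_dir_deriv) auto
  also have "\<dots> = (\<Sum>q<m. t ^ q / fact q * (LINT z|lborel. dir_deriv q \<eta> z x * f z))"
    by (simp add: mult_ac flip: integral_mult_right_zero)
  also have "\<dots> = 0"
    using integral_monomial_dir_deriv_eq_0[OF assms(1), where \<alpha> = "\<lambda>_. 0"] assms(2)
    by (intro sum.neutral) auto
  finally show ?thesis .
qed

lemma integrable_indicator_cball:
  "integrable lborel (indicator (cball a r) :: 'a::euclidean_space \<Rightarrow> real)"
  using emeasure_bounded_finite[OF bounded_cball]
  by (intro integrable_real_indicator) (auto simp: top.not_eq_extremum)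

definition scaled_convolution ::
    "('a::euclidean_space \<Rightarrow> real) \<Rightarrow> ('a \<Rightarrow> real) \<Rightarrow> real \<Rightarrow> 'a \<Rightarrow> real" where
  "scaled_convolution \<eta> w \<delta> v = (LINT z|lborel. \<eta> (v - \<delta> *\<^sub>R z) * w z)"

lemma scaled_convolution_integrand_eq_0:
  fixes \<eta> w :: "'a::euclidean_space \<Rightarrow> real"
  assumes \<eta>: "vanishes_outside R \<eta>" and w: "vanishes_outside S w" and \<delta>: "0 \<le> \<delta>"
    and v: "R + \<delta> * S < norm v"
  shows "\<eta> (v - \<delta> *\<^sub>R z) * w z = 0"
proof (cases "norm z \<le> S")
  case True
  then have "norm (\<delta> *\<^sub>R z) \<le> \<delta> * S" using \<delta> by (simp add: mult_left_mono)
  then have "R < norm (v - \<delta> *\<^sub>R z)" using v norm_triangle_ineq2[of v "\<delta> *\<^sub>R z"] by linarith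
  then show ?thesis using vanishes_outsideD[OF \<eta>] by simp
next
  case False
  then show ?thesis using vanishes_outsideD[OF w] by simp
qed

lemma vanishes_outside_scaled_convolution:
  fixes \<eta> w :: "'a::euclidean_space \<Rightarrow> real"
  assumes "vanishes_outside R \<eta>" "vanishes_outside S w" "0 \<le> \<delta>"
  shows "vanishes_outside (R + \<delta> * S) (scaled_convolution \<eta> w \<delta>)"
  unfolding vanishes_outside_def
proof (intro allI impI)
  fix v :: 'a assume "R + \<delta> * S < norm v"
  from scaled_convolution_integrand_eq_0[OF assms this]
  have "scaled_convolution \<eta> w \<delta> v = (LINT z|(lborel :: 'a measure). 0)"
    unfolding scaled_convolution_def by (rule Bochner_Integration.integral_cong[OF refl])
  then show "scaled_convolution \<eta> w \<delta> v = 0" by simp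
qed

lemma abs_scaled_convolution_le:
  fixes \<eta> w :: "real^'n \<Rightarrow> real"
  assumes \<eta>: "bump m R M \<eta>" and w: "bump k S W w"
    and moments: "vanishing_moments L w" "m \<le> Suc L" and \<delta>: "0 \<le> \<delta>"
  shows "\<bar>scaled_convolution \<eta> w \<delta> v\<bar> \<le> (real CARD('n) * S * \<delta>) ^ m * M * W"
proof -
  interpret \<eta>: bump m R M \<eta> by fact
  interpret w: bump k S W w by fact
  let ?c = "(real CARD('n) * S * \<delta>) ^ m * M"
  define T where "T z = (\<Sum>q<m. dir_deriv q \<eta> z v / fact q * (- \<delta>) ^ q)" for z
  have "continuous_on UNIV (\<lambda>z. \<eta> (v - \<delta> *\<^sub>R z))"
    by (intro continuous_on_compose2[OF \<eta>.continuous] continuous_intros) auto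
  moreover have "continuous_on UNIV T"
    unfolding T_def by (intro continuous_intros continuous_on_dir_deriv) auto
  ultimately have integrable:
    "integrable lborel (\<lambda>z. \<eta> (v - \<delta> *\<^sub>R z) * w z)" "integrable lborel (\<lambda>z. T z * w z)"
    by (auto intro: w.integrable_continuous_mult)
  have "(LINT z|lborel. T z * w z) = 0"
    unfolding T_def by (rule w.integral_taylor_polynomial_eq_0[OF moments])
  then have "scaled_convolution \<eta> w \<delta> v = (LINT z|lborel. \<eta> (v - \<delta> *\<^sub>R z) * w z - T z * w z)"
    using integrable by (simp add: scaled_convolution_def)
  also have "\<bar>\<dots>\<bar> \<le> (LINT z|lborel. \<bar>\<eta> (v - \<delta> *\<^sub>R z) * w z - T z * w z\<bar>)" by (rule integral_abs_bound)
  also have "\<dots> \<le> (LINT z|lborel. ?c * \<bar>w z\<bar>)"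
  proof (rule integral_mono)
    show "\<bar>\<eta> (v - \<delta> *\<^sub>R z) * w z - T z * w z\<bar> \<le> ?c * \<bar>w z\<bar>" for z
    proof (cases "norm z \<le> S")
      case True
      have "\<bar>\<eta> (v - \<delta> *\<^sub>R z) - T z\<bar> \<le> (real CARD('n) * norm z * \<delta>) ^ m * M"
        using abs_taylor_remainder_le[OF \<eta>.smooth \<eta>.deriv_bound, of v "-\<delta>" z] \<delta> by (simp add: T_def)
      also have "\<dots> \<le> ?c"
        using True \<delta> \<eta>.bound_pos by (intro mult_right_mono power_mono mult_left_mono) auto
      finally show ?thesis
        unfolding left_diff_distrib[symmetric] abs_mult by (rule mult_right_mono) simp
    qed (use vanishes_outsideD[OF w.vanishes] in auto)
  qed (use integrable w.integrable in auto)
  also have "\<dots> \<le> ?c * W"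
    using w.L1_bound \<delta> w.radius_pos \<eta>.bound_pos by (auto intro: mult_left_mono)
  finally show ?thesis .
qed

lemma kernel_avg_kernel_avg:
  fixes \<eta> w g :: "real^'n \<Rightarrow> real"
  assumes g: "bounded_borel G g" and \<eta>: "bump m R M \<eta>" and w: "bump k S W w" and \<delta>: "0 \<le> \<delta>"
  shows "kernel_avg w (\<delta> * t) (kernel_avg \<eta> t g) x = kernel_avg (scaled_convolution \<eta> w \<delta>) t g x"
proof -
  interpret \<eta>: bump m R M \<eta> by fact
  interpret w: bump k S W w by fact
  have [measurable]: "g \<in> borel_measurable borel" "\<eta> \<in> borel_measurable borel"
    using bounded_borel_measurable[OF g] \<eta>.measurable by auto
  let ?F = "\<lambda>z v. g (x + t *\<^sub>R v) * \<eta> (v - \<delta> *\<^sub>R z)"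
  let ?\<chi> = "indicator (cball 0 (R + \<delta> * S)) :: real^'n \<Rightarrow> real"
  have indicator: "?F z v * (w z * ?\<chi> v) = ?F z v * w z" for z v
    using scaled_convolution_integrand_eq_0[OF \<eta>.vanishes w.vanishes \<delta>, of v z]
    by (auto simp: indicator_def mult.assoc)
  have "kernel_avg \<eta> t g (x + (\<delta> * t) *\<^sub>R z) = (LINT v|lborel. ?F z v)" for z
    unfolding kernel_avg_def
    by (subst lborel_integral_affine[where c = 1 and t = "- \<delta> *\<^sub>R z"])
      (simp_all add: scaleR_diff_right algebra_simps)
  then have "kernel_avg w (\<delta> * t) (kernel_avg \<eta> t g) x
      = (LINT z|lborel. LINT v|lborel. ?F z v * (w z * ?\<chi> v))"
    unfolding indicator by (simp add: kernel_avg_def)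
  also have "\<dots> = (LINT v|lborel. LINT z|lborel. ?F z v * (w z * ?\<chi> v))"
  proof (rule Fubini_bounded_borel_mult[OF _ w.integrable])
    have "(\<lambda>(z, v). ?F z v) \<in> borel_measurable (borel \<Otimes>\<^sub>M borel)" by measurable
    then show "bounded_borel (G * M) (\<lambda>(z, v). ?F z v)"
      using bounded_borelD[OF g] \<eta>.bound bounded_borel_nonneg[OF g]
      by (auto simp: bounded_borel_def borel_prod abs_mult intro!: mult_mono)
    show "integrable lborel ?\<chi>" by (rule integrable_indicator_cball)
  qed
  also have "\<dots> = kernel_avg (scaled_convolution \<eta> w \<delta>) t g x"
    unfolding indicator by (simp add: kernel_avg_def scaled_convolution_def mult.assoc)
  finally show ?thesis .
qed

lemma abs_kernel_avg_kernel_avg_le: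
  fixes \<eta> w g :: "real^'n \<Rightarrow> real"
  assumes g: "bounded_borel G g" and \<eta>: "bump m R M \<eta>" and w: "bump k S W w"
    and moments: "vanishing_moments L w" "m \<le> Suc L" and \<delta>: "0 \<le> \<delta>" "\<delta> \<le> 1"
  shows "\<bar>kernel_avg w (\<delta> * t) (kernel_avg \<eta> t g) x\<bar>
    \<le> (real CARD('n) * S) ^ m * M * W * measure lborel (cball (0::real^'n) (R + S)) * G * \<delta> ^ m"
proof -
  interpret \<eta>: bump m R M \<eta> by fact
  interpret w: bump k S W w by fact
  have [measurable]:
    "g \<in> borel_measurable borel" "\<eta> \<in> borel_measurable borel" "w \<in> borel_measurable borel"
    using bounded_borel_measurable[OF g] \<eta>.measurable w.measurable by auto
  let ?\<kappa> = "scaled_convolution \<eta> w \<delta>" and ?c = "(real CARD('n) * S * \<delta>) ^ m * M * W"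
  let ?\<chi> = "indicator (cball 0 (R + S)) :: real^'n \<Rightarrow> real"
  have "R + \<delta> * S \<le> R + S" using \<delta> w.radius_pos by (simp add: mult_left_le_one_le)
  then have "vanishes_outside (R + S) ?\<kappa>"
    by (rule vanishes_outside_mono[OF vanishes_outside_scaled_convolution[OF \<eta>.vanishes w.vanishes \<delta>(1)]])
  then have "g (x + t *\<^sub>R v) * ?\<kappa> v = g (x + t *\<^sub>R v) * ?\<kappa> v * ?\<chi> v" for v
    by (auto simp: indicator_def vanishes_outsideD not_le)
  then have "kernel_avg w (\<delta> * t) (kernel_avg \<eta> t g) x
      = (LINT v|lborel. g (x + t *\<^sub>R v) * ?\<kappa> v * ?\<chi> v)"
    unfolding kernel_avg_kernel_avg[OF g \<eta> w \<delta>(1)] kernel_avg_def[of ?\<kappa>] by presburger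
  also have "\<bar>\<dots>\<bar> \<le> G * ?c * (LINT v|lborel. \<bar>?\<chi> v\<bar>)"
  proof (rule abs_integral_bounded_borel_mult_le)
    have "?\<kappa> \<in> borel_measurable borel" unfolding scaled_convolution_def by measurable
    then show "bounded_borel (G * ?c) (\<lambda>v. g (x + t *\<^sub>R v) * ?\<kappa> v)"
      using bounded_borelD[OF g] bounded_borel_nonneg[OF g] abs_scaled_convolution_le[OF \<eta> w moments \<delta>(1)]
      by (auto simp: bounded_borel_def abs_mult intro!: mult_mono)
    show "integrable lborel ?\<chi>" by (rule integrable_indicator_cball)
  qed
  finally show ?thesis by (simp add: power_mult_distrib mult_ac)
qed

section \<open>Approximation kernels\<close>

definition diff_bound :: "nat \<Rightarrow> real \<Rightarrow> real \<Rightarrow> (real^'n \<Rightarrow> real) \<Rightarrow> bool" where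
  "diff_bound m s B f \<longleftrightarrow> (\<forall>h x. \<bar>diffk m h f x\<bar> \<le> B * norm h powr s)"

locale approximation_kernel = bump m R M K
  for m R M and K :: "real^'n \<Rightarrow> real" +
  fixes s E :: real
  assumes exponent_pos: "0 < s" and exponent_less: "s < real m"
    and error_nonneg: "0 \<le> E"
    and approximation: "bounded_borel B f \<Longrightarrow> diff_bound m s B f \<Longrightarrow> 0 < t \<Longrightarrow>
      \<bar>f x - kernel_avg K t f x\<bar> \<le> E * B * t powr s"

text \<open>The coefficients are those of the \<open>m\<close>-th difference, so that subtracting the average from \<open>f\<close>
  leaves an average of \<open>m\<close>-th differences of \<open>f\<close>.\<close>
definition difference_kernel :: "nat \<Rightarrow> (real^'n \<Rightarrow> real) \<Rightarrow> real^'n \<Rightarrow> real" where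
  "difference_kernel m \<eta> u =
     (\<Sum>r=1..m. (-1) ^ Suc r * real (m choose r) / real r ^ CARD('n) * \<eta> ((1 / real r) *\<^sub>R u))"

lemma kernel_avg_dilation:
  fixes \<eta> g :: "'a::euclidean_space \<Rightarrow> real"
  assumes [measurable]: "g \<in> borel_measurable borel" "\<eta> \<in> borel_measurable borel" and r: "0 < r"
  shows "kernel_avg (\<lambda>u. \<eta> ((1 / r) *\<^sub>R u)) t g x = r ^ DIM('a) * kernel_avg \<eta> (r * t) g x"
  unfolding kernel_avg_def using r
  by (subst lborel_integral_affine[where c = r and t = 0]) (simp_all add: mult.commute)

lemma Ck_difference_kernel:
  assumes "Ck m \<eta>"
  shows "Ck m (difference_kernel q \<eta>)"
proof -
  have "Ck m (\<lambda>u. \<eta> ((1 / real r) *\<^sub>R u))" for r using Ck_affine[OF assms, of 0] by simp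
  then show ?thesis
    unfolding difference_kernel_def[abs_def] by (intro Ck_sum Ck_mult Ck_const) auto
qed

lemma vanishes_outside_difference_kernel:
  assumes "vanishes_outside R \<eta>"
  shows "vanishes_outside (real q * \<bar>R\<bar>) (difference_kernel q \<eta>)"
  unfolding vanishes_outside_def difference_kernel_def
proof (intro allI impI sum.neutral ballI)
  fix u :: "real^'a" and r assume u: "real q * \<bar>R\<bar> < norm u" and r: "r \<in> {1..q}"
  have "R * real r \<le> \<bar>R\<bar> * real q" using r by (intro mult_mono) auto
  then have "R < norm ((1 / real r) *\<^sub>R u)" using u r by (simp add: less_divide_eq mult.commute)
  then show "(-1) ^ Suc r * real (q choose r) / real r ^ CARD('a) * \<eta> ((1 / real r) *\<^sub>R u) = 0"
    using vanishes_outsideD[OF assms] by simp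
qed

lemma (in bump) kernel_avg_difference_kernel:
  assumes g: "bounded_borel G g"
  shows "kernel_avg (difference_kernel m f) t g x
    = (\<Sum>r=1..m. (-1) ^ Suc r * real (m choose r) * kernel_avg f (real r * t) g x)"
proof -
  let ?c = "\<lambda>r. (-1) ^ Suc r * real (m choose r) / real r ^ CARD('n)"
  have integrable: "integrable lborel (\<lambda>u. g (x + t *\<^sub>R u) * f ((1 / real r) *\<^sub>R u))" if "0 < r" for r
  proof (rule integrable_kernel_avg[OF g])
    have "vanishes_outside (real r * R) (\<lambda>u. f ((1 / real r) *\<^sub>R u))"
      using that vanishes_outsideD[OF vanishes]
      by (auto simp: vanishes_outside_def less_divide_eq mult.commute)
    then show "integrable lborel (\<lambda>u. f ((1 / real r) *\<^sub>R u))"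
      by (rule integrable_if_vanishes_outside[rotated])
        (intro continuous_on_compose2[OF continuous] continuous_intros, auto)
  qed
  have "kernel_avg (difference_kernel m f) t g x
      = (LINT u|lborel. (\<Sum>r=1..m. ?c r * (g (x + t *\<^sub>R u) * f ((1 / real r) *\<^sub>R u))))"
    by (simp add: kernel_avg_def difference_kernel_def sum_distrib_left mult_ac)
  also have "\<dots> = (\<Sum>r=1..m. LINT u|lborel. ?c r * (g (x + t *\<^sub>R u) * f ((1 / real r) *\<^sub>R u)))"
    by (intro Bochner_Integration.integral_sum integrable_mult_right integrable) simp
  also have "\<dots> = (\<Sum>r=1..m. ?c r * kernel_avg (\<lambda>u. f ((1 / real r) *\<^sub>R u)) t g x)"
    by (simp add: kernel_avg_def)
  also have "\<dots> = (\<Sum>r=1..m. (-1) ^ Suc r * real (m choose r) * kernel_avg f (real r * t) g x)"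
    by (intro sum.cong refl, subst kernel_avg_dilation)
      (simp_all add: bounded_borel_measurable[OF g] measurable)
  finally show ?thesis .
qed

lemma diffk_eq_diff_sum_binomial:
  "(-1) ^ m * diffk m h f (x + (real m / 2) *\<^sub>R h)
    = f x - (\<Sum>r=1..m. (-1) ^ Suc r * real (m choose r) * f (x + real r *\<^sub>R h))"
proof -
  have "diffk m h f (x + (real m / 2) *\<^sub>R h)
      = (\<Sum>r\<le>m. (-1) ^ (m + r) * real (m choose r) * f (x + real r *\<^sub>R h))"
    unfolding diffk_eq_sum_binomial by (simp add: algebra_simps)
  then have "(-1) ^ m * diffk m h f (x + (real m / 2) *\<^sub>R h)
      = (\<Sum>r\<le>m. (-1) ^ r * real (m choose r) * f (x + real r *\<^sub>R h))"
    by (simp add: sum_distrib_left power_add mult.assoc[symmetric] flip: power_mult_distrib)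
  also have "{..m} = insert 0 {1..m}" by auto
  finally show ?thesis by (simp add: sum_negf)
qed

lemma (in bump) diff_kernel_avg_difference_kernel:
  assumes g: "bounded_borel G g" and mass: "(LINT u|lborel. f u) = 1"
  shows "g x - kernel_avg (difference_kernel m f) t g x
    = (LINT u|lborel. (-1) ^ m * diffk m (t *\<^sub>R u) g (x + (real m / 2) *\<^sub>R t *\<^sub>R u) * f u)"
proof -
  let ?a = "\<lambda>r. (-1) ^ Suc r * real (m choose r)"
  have terms: "integrable lborel (\<lambda>u. ?a r * (g (x + (real r * t) *\<^sub>R u) * f u))" for r
    by (intro integrable_mult_right integrable_kernel_avg[OF g] integrable)
  have "(LINT u|lborel. (-1) ^ m * diffk m (t *\<^sub>R u) g (x + (real m / 2) *\<^sub>R t *\<^sub>R u) * f u)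
      = (LINT u|lborel. g x * f u - (\<Sum>r=1..m. ?a r * (g (x + (real r * t) *\<^sub>R u) * f u)))"
    unfolding diffk_eq_diff_sum_binomial left_diff_distrib sum_distrib_right
    by (simp add: mult.assoc)
  also have "\<dots> = (LINT u|lborel. g x * f u)
      - (LINT u|lborel. (\<Sum>r=1..m. ?a r * (g (x + (real r * t) *\<^sub>R u) * f u)))"
    by (intro Bochner_Integration.integral_diff Bochner_Integration.integrable_sum
        integrable_mult_right[OF integrable] terms)
  also have "(LINT u|lborel. (\<Sum>r=1..m. ?a r * (g (x + (real r * t) *\<^sub>R u) * f u)))
      = (\<Sum>r=1..m. LINT u|lborel. ?a r * (g (x + (real r * t) *\<^sub>R u) * f u))"
    by (intro Bochner_Integration.integral_sum terms)
  also have "\<dots> = kernel_avg (difference_kernel m f) t g x"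
    unfolding kernel_avg_difference_kernel[OF g] by (simp add: kernel_avg_def)
  also have "(LINT u|lborel. g x * f u) = g x" using mass by simp
  finally show ?thesis by simp
qed

lemma (in bump) abs_diff_kernel_avg_difference_kernel_le:
  assumes g: "bounded_borel B g" and diff: "diff_bound m s B g"
    and mass: "(LINT u|lborel. f u) = 1" and "0 < t" "0 < s"
  shows "\<bar>g x - kernel_avg (difference_kernel m f) t g x\<bar> \<le> R powr s * M * B * t powr s"
proof -
  let ?e = "\<lambda>u. (-1) ^ m * diffk m (t *\<^sub>R u) g (x + (real m / 2) *\<^sub>R t *\<^sub>R u)"
  let ?c = "B * (t * R) powr s"
  have [measurable]: "g \<in> borel_measurable borel" by (rule bounded_borel_measurable[OF g])
  have B: "0 \<le> B" by (rule bounded_borel_nonneg[OF g])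
  have "\<bar>?e u\<bar> \<le> ?c" if "norm u \<le> R" for u
  proof -
    have "\<bar>?e u\<bar> \<le> B * norm (t *\<^sub>R u) powr s"
      using diff unfolding diff_bound_def by (simp add: abs_mult power_abs del: norm_scaleR)
    also have "\<dots> \<le> ?c"
      using that \<open>0 < t\<close> \<open>0 < s\<close> B by (intro mult_left_mono powr_mono2) auto
    finally show ?thesis .
  qed
  moreover have "?e \<in> borel_measurable borel"
    unfolding diffk_eq_diff_sum_binomial by measurable
  ultimately have cutoff: "bounded_borel ?c (\<lambda>u. ?e u * indicator (cball 0 R) u)"
    using B by (auto simp: bounded_borel_def indicator_def)
  have "g x - kernel_avg (difference_kernel m f) t g x
      = (LINT u|lborel. ?e u * indicator (cball 0 R) u * f u)"
    unfolding diff_kernel_avg_difference_kernel[OF g mass]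
    using vanishes_outsideD[OF vanishes]
    by (intro Bochner_Integration.integral_cong refl) (auto simp: indicator_def not_le)
  also have "\<bar>\<dots>\<bar> \<le> ?c * (LINT u|lborel. \<bar>f u\<bar>)"
    by (rule abs_integral_bounded_borel_mult_le[OF cutoff integrable])
  also have "\<dots> \<le> ?c * M"
    using B L1_bound by (intro mult_left_mono) auto
  also have "\<dots> = R powr s * M * B * t powr s"
    using \<open>0 < t\<close> radius_pos by (simp add: powr_mult mult_ac)
  finally show ?thesis .
qed

theorem (in bump) ex_approximation_kernel:
  assumes mass: "(LINT u|lborel. f u) = 1" and s: "0 < s" "s < real k"
  shows "\<exists>R' M' (K :: real^'n \<Rightarrow> real) E. approximation_kernel k R' M' K s E"
proof -
  obtain R' M' where "bump k R' M' (difference_kernel k f)"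
    using ex_bump[OF Ck_difference_kernel[OF smooth] vanishes_outside_difference_kernel[OF vanishes]]
    by blast
  then interpret K: bump k R' M' "difference_kernel k f" .
  have "approximation_kernel k R' M' (difference_kernel k f) s (R powr s * M)"
    using s bound_pos abs_diff_kernel_avg_difference_kernel_le[OF _ _ mass]
    by unfold_locales auto
  then show ?thesis by blast
qed

section \<open>Decay of wavelet coefficients\<close>

lemma half_power_powr: "((1/2::real) ^ j) powr s = (2 powr (- s)) ^ j"
  by (simp add: powr_minus powr_divide inverse_eq_divide power_one_over powr_powr mult.commute
      flip: powr_realpow)

lemma half_power_less_two_powr:
  assumes "s < real m"
  shows "(1/2::real) ^ m < 2 powr (- s)"
proof -
  have "(2::real) powr (- real m) < 2 powr (- s)" using assms by simp
  then show ?thesis by (simp add: powr_minus powr_realpow power_one_over inverse_eq_divide)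
qed

lemma geometric_convolution_le:
  fixes p d :: real
  assumes "0 < d" "d < p"
  shows "(\<Sum>i<j. p ^ i * d ^ (j - i)) \<le> p ^ j * (d / (p - d))"
proof (induction j)
  case (Suc j)
  have "(\<Sum>i<Suc j. p ^ i * d ^ (Suc j - i)) = d * (\<Sum>i<j. p ^ i * d ^ (j - i)) + p ^ j * d"
    by (simp add: sum_distrib_left Suc_diff_le mult_ac)
  also have "\<dots> \<le> d * (p ^ j * (d / (p - d))) + p ^ j * d"
    using Suc assms by (intro add_mono mult_left_mono) auto
  also have "\<dots> = p ^ Suc j * (d / (p - d))"
    using assms by (simp add: field_simps)
  finally show ?case .
qed (use assms in simp)

context approximation_kernel
begin

definition approx :: "nat \<Rightarrow> (real^'n \<Rightarrow> real) \<Rightarrow> real^'n \<Rightarrow> real" where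
  "approx i = kernel_avg K ((1/2) ^ i)"

definition increment :: "nat \<Rightarrow> (real^'n \<Rightarrow> real) \<Rightarrow> real^'n \<Rightarrow> real" where
  "increment i f x = approx (Suc i) f x - approx i f x"

definition moment_const :: "real \<Rightarrow> real \<Rightarrow> real" where
  "moment_const S W = (real CARD('n) * S) ^ m * M * W * measure lborel (cball (0::real^'n) (R + S))"

definition decay_const :: "real \<Rightarrow> real \<Rightarrow> real" where
  "decay_const S W = (W + moment_const S W) * E
     + moment_const S W * (M + 4 * E / (2 powr (- s) - (1/2) ^ m))"

lemma moment_const_nonneg: "0 < S \<Longrightarrow> 0 < W \<Longrightarrow> 0 \<le> moment_const S W"
  using bound_pos by (simp add: moment_const_def)

lemma decay_const_nonneg: "0 < S \<Longrightarrow> 0 < W \<Longrightarrow> 0 \<le> decay_const S W"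
  using half_power_less_two_powr[OF exponent_less] error_nonneg bound_pos moment_const_nonneg[of S W]
  by (simp add: decay_const_def)

lemma bounded_borel_approx: "bounded_borel G g \<Longrightarrow> bounded_borel (G * M) (approx i g)"
  unfolding approx_def by (rule bounded_borel_kernel_avg)

lemma approx_diff:
  "bounded_borel G g \<Longrightarrow> bounded_borel H h \<Longrightarrow> approx i (\<lambda>x. g x - h x) x = approx i g x - approx i h x"
  unfolding approx_def by (rule kernel_avg_diff[OF _ _ integrable])

lemma bounded_borel_diff_approx:
  assumes f: "bounded_borel B f" and diff: "diff_bound m s B f"
  shows "bounded_borel (E * B * (2 powr (- s)) ^ i) (\<lambda>x. f x - approx i f x)"
proof -
  have "\<bar>f x - approx i f x\<bar> \<le> E * B * (2 powr (- s)) ^ i" for x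
    using approximation[OF f diff, of "(1/2) ^ i" x] by (simp add: approx_def half_power_powr)
  moreover have "(\<lambda>x. f x - approx i f x) \<in> borel_measurable borel"
    by (intro borel_measurable_diff bounded_borel_measurable[OF f]
        bounded_borel_measurable[OF bounded_borel_approx[OF f]])
  ultimately show ?thesis by (simp add: bounded_borel_def)
qed

lemma bounded_borel_increment:
  assumes f: "bounded_borel B f" and diff: "diff_bound m s B f"
  shows "bounded_borel (2 * E * B * (2 powr (- s)) ^ i) (increment i f)"
proof -
  let ?p = "2 powr (- s)"
  have "\<bar>increment i f x\<bar> \<le> 2 * E * B * ?p ^ i" for x
  proof -
    have "?p ^ Suc i \<le> ?p ^ i"
      using exponent_pos powr_less_one[of 2 "- s"] by (intro power_decreasing) auto
    then have "E * B * ?p ^ Suc i \<le> E * B * ?p ^ i"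
      using error_nonneg bounded_borel_nonneg[OF f] by (intro mult_left_mono) auto
    then show ?thesis
      using bounded_borelD[OF bounded_borel_diff_approx[OF f diff, of i], of x]
        bounded_borelD[OF bounded_borel_diff_approx[OF f diff, of "Suc i"], of x]
      unfolding increment_def by linarith
  qed
  moreover have "increment i f \<in> borel_measurable borel"
    unfolding increment_def[abs_def]
    by (intro borel_measurable_diff bounded_borel_measurable[OF bounded_borel_approx[OF f]])
  ultimately show ?thesis by (simp add: bounded_borel_def)
qed

text \<open>This is the factorisation \<open>P\<^sub>i\<^sub>+\<^sub>1\<^sup>2 - P\<^sub>i\<^sup>2 = (P\<^sub>i\<^sub>+\<^sub>1 + P\<^sub>i) (P\<^sub>i\<^sub>+\<^sub>1 - P\<^sub>i)\<close> of commuting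
  operators: the inner difference is of size \<open>2\<^sup>-\<^sup>i\<^sup>s\<close>, and the outer average is smooth enough for
  vanishing moments to act.\<close>
lemma approx_square_diff:
  assumes f: "bounded_borel B f"
  shows "approx (Suc i) (approx (Suc i) f) x - approx i (approx i f) x
    = approx (Suc i) (increment i f) x + approx i (increment i f) x"
proof -
  have "approx (Suc i) (approx i f) x = approx i (approx (Suc i) f) x"
    unfolding approx_def by (rule kernel_avg_commute[OF f integrable integrable])
  then show ?thesis
    unfolding increment_def[abs_def]
    by (simp add: approx_diff[OF bounded_borel_approx[OF f] bounded_borel_approx[OF f]])
qed

context
  fixes k L :: nat and S W :: real and w :: "real^'n \<Rightarrow> real"
  assumes test: "bump k S W w" and moments: "vanishing_moments L w" and order: "m \<le> Suc L"
begin

interpretation test: bump k S W w by (rule test)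

lemma abs_kernel_avg_approx_le:
  assumes g: "bounded_borel G g" and "i \<le> j"
  shows "\<bar>kernel_avg w ((1/2) ^ j) (approx i g) a\<bar> \<le> moment_const S W * G * ((1/2) ^ m) ^ (j - i)"
proof -
  have "(1/2::real) ^ (j - i) * (1/2) ^ i = (1/2) ^ j"
    using \<open>i \<le> j\<close> by (simp flip: power_add)
  then show ?thesis
    using abs_kernel_avg_kernel_avg_le[OF g bump_axioms test moments order,
        of "(1/2) ^ (j - i)" "(1/2) ^ i" a]
    by (simp add: approx_def moment_const_def power_le_one mult.commute flip: power_mult)
qed

lemma kernel_avg_test_diff:
  "bounded_borel G g \<Longrightarrow> bounded_borel H h \<Longrightarrow>
   kernel_avg w t (\<lambda>x. g x - h x) a = kernel_avg w t g a - kernel_avg w t h a"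
  by (rule kernel_avg_diff[OF _ _ test.integrable])

lemma abs_kernel_avg_approx_square_step_le:
  assumes f: "bounded_borel B f" and diff: "diff_bound m s B f" and "i < j"
  shows "\<bar>kernel_avg w ((1/2) ^ j) (approx (Suc i) (approx (Suc i) f)) a
      - kernel_avg w ((1/2) ^ j) (approx i (approx i f)) a\<bar>
    \<le> 4 * moment_const S W * E * B / (1/2) ^ m * ((2 powr (- s)) ^ i * ((1/2) ^ m) ^ (j - i))"
proof -
  let ?\<Phi> = "kernel_avg w ((1/2) ^ j)" and ?\<Delta> = "increment i f" and ?d = "(1/2::real) ^ m"
  define c where "c = moment_const S W * (2 * E * B * (2 powr (- s)) ^ i)"
  note \<Delta> = bounded_borel_increment[OF f diff, of i]
  note square = bounded_borel_approx[OF bounded_borel_approx[OF f]]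
  have "?\<Phi> (approx (Suc i) (approx (Suc i) f)) a - ?\<Phi> (approx i (approx i f)) a
      = ?\<Phi> (\<lambda>x. approx (Suc i) ?\<Delta> x + approx i ?\<Delta> x) a"
    unfolding kernel_avg_test_diff[OF square square, symmetric] approx_square_diff[OF f] ..
  also have "\<dots> = ?\<Phi> (approx (Suc i) ?\<Delta>) a + ?\<Phi> (approx i ?\<Delta>) a"
    by (rule kernel_avg_add[OF bounded_borel_approx[OF \<Delta>] bounded_borel_approx[OF \<Delta>] test.integrable])
  finally have "\<bar>?\<Phi> (approx (Suc i) (approx (Suc i) f)) a - ?\<Phi> (approx i (approx i f)) a\<bar>
      \<le> c * ?d ^ (j - Suc i) + c * ?d ^ (j - i)"
    using abs_kernel_avg_approx_le[OF \<Delta>, of "Suc i" j a] abs_kernel_avg_approx_le[OF \<Delta>, of i j a] \<open>i < j\<close>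
    unfolding c_def by linarith
  also have "\<dots> \<le> 2 * (c * (?d ^ (j - i) / ?d))"
  proof -
    have "?d ^ (j - i) = ?d * ?d ^ (j - Suc i)"
      using \<open>i < j\<close> by (simp add: Suc_diff_Suc flip: power_Suc)
    moreover have "?d * ?d ^ (j - Suc i) \<le> ?d ^ (j - Suc i)"
      by (simp add: mult_left_le_one_le power_le_one)
    ultimately have shift: "?d ^ (j - Suc i) = ?d ^ (j - i) / ?d" and "?d ^ (j - i) \<le> ?d ^ (j - i) / ?d"
      by simp_all
    moreover have "0 \<le> c"
      using bounded_borel_nonneg[OF \<Delta>] moment_const_nonneg[OF test.radius_pos test.bound_pos]
      by (simp add: c_def)
    ultimately have "c * ?d ^ (j - i) \<le> c * (?d ^ (j - i) / ?d)" by (intro mult_left_mono)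
    then show ?thesis unfolding shift mult_2 by (rule add_left_mono)
  qed
  finally show ?thesis by (simp add: c_def mult_ac)
qed

lemma abs_kernel_avg_approx_square_le:
  assumes f: "bounded_borel B f" and diff: "diff_bound m s B f"
  shows "\<bar>kernel_avg w ((1/2) ^ j) (approx j (approx j f)) a\<bar>
    \<le> moment_const S W * (M + 4 * E / (2 powr (- s) - (1/2) ^ m)) * B * (2 powr (- s)) ^ j"
proof -
  let ?p = "2 powr (- s)" and ?d = "(1/2::real) ^ m" and ?Q = "moment_const S W"
  define \<Phi> where "\<Phi> i = kernel_avg w ((1/2) ^ j) (approx i (approx i f)) a" for i
  note nonneg = moment_const_nonneg[OF test.radius_pos test.bound_pos] error_nonneg
    bounded_borel_nonneg[OF f]
  have d_less: "?d < ?p" by (rule half_power_less_two_powr[OF exponent_less])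
  have "\<bar>\<Phi> 0\<bar> \<le> ?Q * (B * M) * ?d ^ j"
    unfolding \<Phi>_def using abs_kernel_avg_approx_le[OF bounded_borel_approx[OF f], of 0 j 0] by simp
  also have "\<dots> \<le> ?Q * (B * M) * ?p ^ j"
    using nonneg bound_pos d_less by (intro mult_left_mono power_mono) auto
  finally have coarse: "\<bar>\<Phi> 0\<bar> \<le> ?Q * (B * M) * ?p ^ j" .
  have "\<bar>\<Sum>i<j. \<Phi> (Suc i) - \<Phi> i\<bar> \<le> (\<Sum>i<j. 4 * ?Q * E * B / ?d * (?p ^ i * ?d ^ (j - i)))"
    unfolding \<Phi>_def
    by (intro order_trans[OF sum_abs] sum_mono abs_kernel_avg_approx_square_step_le[OF f diff]) auto
  also have "\<dots> = 4 * ?Q * E * B / ?d * (\<Sum>i<j. ?p ^ i * ?d ^ (j - i))"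
    by (simp only: sum_distrib_left)
  also have "\<dots> \<le> 4 * ?Q * E * B / ?d * (?p ^ j * (?d / (?p - ?d)))"
    using nonneg d_less by (intro mult_left_mono geometric_convolution_le) auto
  finally have "\<bar>\<Sum>i<j. \<Phi> (Suc i) - \<Phi> i\<bar> \<le> 4 * ?Q * E * B * ?p ^ j / (?p - ?d)"
    by simp
  moreover have "\<Phi> j = \<Phi> 0 + (\<Sum>i<j. \<Phi> (Suc i) - \<Phi> i)"
    by (subst sum_lessThan_telescope) simp
  ultimately have "\<bar>\<Phi> j\<bar> \<le> ?Q * (B * M) * ?p ^ j + 4 * ?Q * E * B * ?p ^ j / (?p - ?d)"
    using coarse by linarith
  then show ?thesis by (simp add: \<Phi>_def algebra_simps)
qed

lemma abs_kernel_avg_diff_approx_square_le: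
  assumes f: "bounded_borel B f" and diff: "diff_bound m s B f"
  shows "\<bar>kernel_avg w ((1/2) ^ j) f a - kernel_avg w ((1/2) ^ j) (approx j (approx j f)) a\<bar>
    \<le> (W + moment_const S W) * E * B * (2 powr (- s)) ^ j"
proof -
  let ?\<Phi> = "kernel_avg w ((1/2) ^ j)" and ?e = "\<lambda>x. f x - approx j f x"
  note error = bounded_borel_diff_approx[OF f diff, of j]
  note approx = bounded_borel_approx[OF f] bounded_borel_approx[OF bounded_borel_approx[OF f]]
  have "?\<Phi> f a - ?\<Phi> (approx j f) a = ?\<Phi> ?e a"
    by (rule kernel_avg_test_diff[OF f approx(1), symmetric])
  moreover have "?\<Phi> (approx j f) a - ?\<Phi> (approx j (approx j f)) a = ?\<Phi> (approx j ?e) a"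
    unfolding kernel_avg_test_diff[OF approx, symmetric] approx_diff[OF f approx(1), abs_def] ..
  moreover have "\<bar>?\<Phi> ?e a\<bar> \<le> E * B * (2 powr (- s)) ^ j * W"
    by (rule test.abs_kernel_avg_le[OF error])
  moreover have "\<bar>?\<Phi> (approx j ?e) a\<bar> \<le> moment_const S W * (E * B * (2 powr (- s)) ^ j)"
    using abs_kernel_avg_approx_le[OF error, of j j a] by simp
  ultimately have "\<bar>?\<Phi> f a - ?\<Phi> (approx j (approx j f)) a\<bar>
      \<le> E * B * (2 powr (- s)) ^ j * W + moment_const S W * (E * B * (2 powr (- s)) ^ j)"
    by linarith
  then show ?thesis by (simp add: algebra_simps)
qed

theorem abs_kernel_avg_vanishing_moments_le:
  assumes f: "bounded_borel B f" and diff: "diff_bound m s B f"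
  shows "\<bar>kernel_avg w ((1/2) ^ j) f a\<bar> \<le> decay_const S W * B * (2 powr (- s)) ^ j"
  using abs_kernel_avg_diff_approx_square_le[OF f diff, of j a]
    abs_kernel_avg_approx_square_le[OF f diff, of j a]
  unfolding decay_const_def distrib_right by linarith

end

end

section \<open>Lipschitz bounds, lattice sums and dyadic series\<close>

definition lip_bound :: "nat \<Rightarrow> real \<Rightarrow> real \<Rightarrow> (real^'n \<Rightarrow> real) \<Rightarrow> bool" where
  "lip_bound m s B f \<longleftrightarrow> continuous_on UNIV f \<and> (\<forall>x. \<bar>f x\<bar> \<le> B) \<and>
     (\<forall>h x. 0 < norm h \<longrightarrow> norm h \<le> 1 \<longrightarrow> \<bar>diffk m h f x\<bar> \<le> B * norm h powr s)"

lemma lip_bound_nonneg: "lip_bound m s B f \<Longrightarrow> 0 \<le> B"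
  unfolding lip_bound_def using abs_ge_zero order_trans by blast

lemma lip_bound_diff:
  assumes "lip_bound m s B f" "lip_bound m s D g"
  shows "lip_bound m s (B + D) (\<lambda>x. f x - g x)"
  using assms unfolding lip_bound_def diffk_diff distrib_right
  by (auto intro!: continuous_on_diff order_trans[OF abs_triangle_ineq4] add_mono)

lemma lip_bound_imp_bounded_borel: "lip_bound m s B f \<Longrightarrow> bounded_borel B f"
  by (simp add: bounded_borel_def lip_bound_def borel_measurable_continuous_onI)

lemma lip_bound_imp_diff_bound:
  fixes f :: "real^'n \<Rightarrow> real"
  assumes f: "lip_bound m s B f" and "0 < m" "0 \<le> s"
  shows "diff_bound m s (2 ^ m * B) f"
  unfolding diff_bound_def
proof (intro allI)
  fix h x :: "real^'n"
  have B: "0 \<le> B" by (rule lip_bound_nonneg[OF f])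
  consider (zero) "h = 0" | (small) "0 < norm h" "norm h \<le> 1" | (large) "1 < norm h" by force
  then show "\<bar>diffk m h f x\<bar> \<le> 2 ^ m * B * norm h powr s"
  proof cases
    case zero
    with \<open>0 < m\<close> show ?thesis by (cases m) (simp_all add: diffk_zero_step)
  next
    case small
    then have "\<bar>diffk m h f x\<bar> \<le> B * norm h powr s" using f by (simp add: lip_bound_def)
    also have "\<dots> \<le> 2 ^ m * B * norm h powr s"
      using B by (intro mult_right_mono) (auto simp: mult_le_cancel_right1)
    finally show ?thesis .
  next
    case large
    have "\<bar>diffk m h f x\<bar> \<le> 2 ^ m * B * 1"
      using f abs_diffk_le[of f B] by (simp add: lip_bound_def)
    also have "\<dots> \<le> 2 ^ m * B * norm h powr s"
      using B large ge_one_powr_ge_zero[of "norm h" s] \<open>0 \<le> s\<close> by (intro mult_left_mono) auto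
    finally show ?thesis .
  qed
qed

definition lattice_count :: "nat \<Rightarrow> real \<Rightarrow> real" where
  "lattice_count n R = (real (nat \<lfloor>2 * R\<rfloor>) + 1) ^ n"

lemma
  fixes x :: "real^'n"
  shows finite_lattice_points_cball: "finite {z. norm (x - ivec z) \<le> R}"
    and card_lattice_points_cball_le:
      "real (card {z. norm (x - ivec z) \<le> R}) \<le> lattice_count CARD('n) R"
proof -
  let ?I = "\<lambda>i. {\<lceil>x $ i - R\<rceil>..\<lfloor>x $ i + R\<rfloor>}"
  have subset: "{z. norm (x - ivec z) \<le> R} \<subseteq> vec_lambda ` PiE UNIV ?I"
  proof clarify
    fix z :: "int^'n" assume "norm (x - ivec z) \<le> R"
    then have "\<bar>x $ i - real_of_int (z $ i)\<bar> \<le> R" for i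
      using component_le_norm_cart[of "x - ivec z" i] by (simp add: ivec_def)
    then have "(\<lambda>i. z $ i) \<in> PiE UNIV ?I"
      by (auto simp: ceiling_le_iff le_floor_iff abs_le_iff algebra_simps)
    moreover have "z = vec_lambda (\<lambda>i. z $ i)" by simp
    ultimately show "z \<in> vec_lambda ` PiE UNIV ?I" by blast
  qed
  have box: "finite (vec_lambda ` PiE (UNIV :: 'n set) ?I)" by (intro finite_imageI finite_PiE) auto
  then show "finite {z. norm (x - ivec z) \<le> R}" by (rule finite_subset[OF subset])
  have "card {z. norm (x - ivec z) \<le> R} \<le> card (vec_lambda ` PiE (UNIV :: 'n set) ?I)"
    by (rule card_mono[OF box subset])
  also have "\<dots> \<le> card (PiE (UNIV :: 'n set) ?I)" by (intro card_image_le finite_PiE) auto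
  also have "\<dots> = (\<Prod>i\<in>UNIV. card (?I i))" by (rule card_PiE) simp
  also have "\<dots> \<le> (\<Prod>i\<in>(UNIV :: 'n set). nat \<lfloor>2 * R\<rfloor> + 1)"
  proof (intro prod_mono conjI)
    fix i show "card (?I i) \<le> nat \<lfloor>2 * R\<rfloor> + 1" by simp linarith
  qed simp
  finally have "real (card {z. norm (x - ivec z) \<le> R}) \<le> real (\<Prod>i\<in>(UNIV :: 'n set). nat \<lfloor>2 * R\<rfloor> + 1)"
    by (rule of_nat_mono)
  then show "real (card {z. norm (x - ivec z) \<le> R}) \<le> lattice_count CARD('n) R"
    by (simp add: lattice_count_def add.commute)
qed

definition lattice_sum :: "(real^'n \<Rightarrow> real) \<Rightarrow> (int^'n \<Rightarrow> real) \<Rightarrow> real^'n \<Rightarrow> real" where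
  "lattice_sum w d x = (\<Sum>\<^sub>\<infinity>z. d z * w (x - ivec z))"

lemma lattice_sum_eq_sum:
  assumes "vanishes_outside R w" "finite F" "{z. norm (x - ivec z) \<le> R} \<subseteq> F"
  shows "lattice_sum w d x = (\<Sum>z\<in>F. d z * w (x - ivec z))"
proof -
  have "w (x - ivec z) = 0" if "z \<notin> F" for z
    using assms(3) that by (intro vanishes_outsideD[OF assms(1)]) (auto simp: not_le[symmetric])
  then have "lattice_sum w d x = infsum (\<lambda>z. d z * w (x - ivec z)) F"
    unfolding lattice_sum_def by (intro infsum_cong_neutral) auto
  then show ?thesis using assms(2) by simp
qed

lemma diff1_lattice_sum:
  fixes w :: "real^'n \<Rightarrow> real"
  assumes w: "vanishes_outside R w"
  shows "diff1 h (lattice_sum w d) = lattice_sum (diff1 h w) d"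
proof
  fix x :: "real^'n"
  let ?F = "{z. norm (x - ivec z) \<le> R + norm h / 2}"
  have finite: "finite ?F" by (rule finite_lattice_points_cball)
  have shift: "lattice_sum w d (x + t) = (\<Sum>z\<in>?F. d z * w (x + t - ivec z))"
    if "norm t = norm h / 2" for t
  proof (rule lattice_sum_eq_sum[OF w finite], safe)
    fix z assume "norm (x + t - ivec z) \<le> R"
    then show "norm (x - ivec z) \<le> R + norm h / 2"
      using that norm_triangle_ineq4[of "x + t - ivec z" t] by (simp add: algebra_simps)
  qed
  have "lattice_sum (diff1 h w) d x = (\<Sum>z\<in>?F. d z * diff1 h w (x - ivec z))"
    by (rule lattice_sum_eq_sum[OF vanishes_outside_diff1[OF w] finite]) simp
  then show "diff1 h (lattice_sum w d) x = lattice_sum (diff1 h w) d x"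
    using shift[of "(1/2) *\<^sub>R h"] shift[of "- (1/2) *\<^sub>R h"]
    by (simp add: diff1_def right_diff_distrib sum_subtractf algebra_simps)
qed

lemma diffk_lattice_sum:
  "vanishes_outside R w \<Longrightarrow> diffk k h (lattice_sum w d) = lattice_sum (diffk k h w) d"
proof (induction k arbitrary: w R)
  case (Suc k)
  from Suc.IH[OF vanishes_outside_diff1[OF Suc.prems]] show ?case
    by (simp add: diffk_Suc_right diff1_lattice_sum[OF Suc.prems])
qed simp

lemma abs_lattice_sum_le:
  fixes w :: "real^'n \<Rightarrow> real"
  assumes w: "vanishes_outside R w" "\<And>x. \<bar>w x\<bar> \<le> V" and d: "\<And>z. \<bar>d z\<bar> \<le> D"
  shows "\<bar>lattice_sum w d x\<bar> \<le> lattice_count CARD('n) R * (D * V)"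
proof -
  have nonneg: "0 \<le> D" "0 \<le> V" using d w(2) abs_ge_zero order_trans by blast+
  let ?F = "{z. norm (x - ivec z) \<le> R}"
  have "\<bar>lattice_sum w d x\<bar> \<le> (\<Sum>z\<in>?F. D * V)"
    unfolding lattice_sum_eq_sum[OF w(1) finite_lattice_points_cball subset_refl]
    by (intro order_trans[OF sum_abs] sum_mono) (auto simp: abs_mult intro!: mult_mono d w(2) nonneg)
  also have "\<dots> \<le> lattice_count CARD('n) R * (D * V)"
    using card_lattice_points_cball_le[of x R] nonneg by (auto intro!: mult_right_mono)
  finally show ?thesis .
qed

lemma continuous_on_lattice_sum:
  fixes w :: "real^'n \<Rightarrow> real"
  assumes "continuous_on UNIV w" "vanishes_outside R w"
  shows "continuous_on UNIV (lattice_sum w d)"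
proof -
  have "isCont (lattice_sum w d) a" for a
  proof -
    let ?F = "{z. norm (a - ivec z) \<le> R + 1}"
    have "lattice_sum w d x = (\<Sum>z\<in>?F. d z * w (x - ivec z))" if "x \<in> ball a 1" for x
    proof (rule lattice_sum_eq_sum[OF assms(2) finite_lattice_points_cball], safe)
      fix z assume "norm (x - ivec z) \<le> R"
      then show "norm (a - ivec z) \<le> R + 1"
        using that norm_triangle_ineq[of "a - x" "x - ivec z"] by (auto simp: dist_norm)
    qed
    moreover have "continuous_on (ball a 1) (\<lambda>x. \<Sum>z\<in>?F. d z * w (x - ivec z))"
      by (intro continuous_intros continuous_on_compose2[OF assms(1)]) auto
    ultimately have "continuous_on (ball a 1) (lattice_sum w d)"
      by (metis (no_types, lifting) continuous_on_cong)
    then show ?thesis by (simp add: continuous_on_eq_continuous_at)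
  qed
  then show ?thesis by (simp add: continuous_at_imp_continuous_on)
qed

definition lattice_const :: "nat \<Rightarrow> nat \<Rightarrow> real \<Rightarrow> real \<Rightarrow> real" where
  "lattice_const n k R M = lattice_count n (R + real k) * M * (2 * real n) ^ k"

lemma lattice_count_pos: "0 < lattice_count n R"
  by (simp add: lattice_count_def add_nonneg_pos)

lemma lattice_const_pos: "0 < n \<Longrightarrow> 0 < M \<Longrightarrow> 0 < lattice_const n k R M"
  using lattice_count_pos by (simp add: lattice_const_def)

lemma (in bump) abs_lattice_sum_bump_le:
  assumes d: "\<And>z. \<bar>d z\<bar> \<le> D"
  shows "\<bar>lattice_sum f d x\<bar> \<le> lattice_const CARD('n) k R M * D"
proof -
  have D: "0 \<le> D" using d abs_ge_zero order_trans by blast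
  have "\<bar>lattice_sum f d x\<bar> \<le> lattice_count CARD('n) (R + real k) * (D * M) * 1"
    using abs_lattice_sum_le[OF vanishes_outside_mono[OF vanishes] bound d, of "R + real k"] by simp
  also have "\<dots> \<le> lattice_count CARD('n) (R + real k) * (D * M) * (2 * real CARD('n)) ^ k"
  proof (rule mult_left_mono)
    have "1 \<le> real CARD('n)" by (simp add: Suc_le_eq)
    then show "1 \<le> (2 * real CARD('n)) ^ k" by (intro one_le_power) linarith
  qed (use D bound_pos less_imp_le[OF lattice_count_pos] in simp)
  finally show ?thesis by (simp add: lattice_const_def mult_ac)
qed

lemma (in bump) abs_diffk_lattice_sum_bump_le:
  assumes d: "\<And>z. \<bar>d z\<bar> \<le> D"
  shows "\<bar>diffk k h (lattice_sum f d) x\<bar> \<le> lattice_const CARD('n) k R M * D * min 1 (norm h ^ k)"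
proof -
  let ?c = "lattice_count CARD('n) (R + real k) * M * D"
  have const_nonneg: "0 \<le> ?c"
    using d[of undefined] bound_pos less_imp_le[OF lattice_count_pos[of "CARD('n)" "R + real k"]] by simp
  show ?thesis
  proof (cases "norm h \<le> 1")
    case True
    have "vanishes_outside (R + real k) (diffk k h f)"
      by (rule vanishes_outside_mono[OF vanishes_outside_diffk[OF vanishes]])
        (use True in \<open>simp add: mult_left_mono\<close>)
    then have "\<bar>diffk k h (lattice_sum f d) x\<bar>
        \<le> lattice_count CARD('n) (R + real k) * (D * ((real CARD('n) * norm h) ^ k * M))"
      unfolding diffk_lattice_sum[OF vanishes]
      by (rule abs_lattice_sum_le[OF _ abs_diffk_le_Ck_bound[OF smooth deriv_bound] d])
    also have "\<dots> = ?c * (real CARD('n) * norm h) ^ k" by (simp only: mult_ac)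
    also have "\<dots> \<le> ?c * (2 * real CARD('n) * norm h) ^ k"
      using const_nonneg by (intro mult_left_mono power_mono mult_right_mono) auto
    finally show ?thesis
      using True power_le_one[of "norm h" k] by (simp add: lattice_const_def power_mult_distrib mult_ac)
  next
    case False
    have "\<bar>diffk k h (lattice_sum f d) x\<bar> \<le> 2 ^ k * (lattice_count CARD('n) (R + real k) * (D * M))"
      by (intro abs_diffk_le abs_lattice_sum_le[OF vanishes_outside_mono[OF vanishes] bound d]) simp
    also have "\<dots> = ?c * 2 ^ k" by (simp only: mult_ac)
    also have "\<dots> \<le> ?c * (2 * real CARD('n)) ^ k"
      using const_nonneg by (intro mult_left_mono power_mono) auto
    finally show ?thesis
      using False one_le_power[of "norm h" k] by (simp add: lattice_const_def min_def mult_ac)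
  qed
qed

definition dyadic_sum_const :: "nat \<Rightarrow> real \<Rightarrow> real" where
  "dyadic_sum_const m s = 1 / (1 - 2 powr (- s)) + 1 / (2 powr (- s) - (1/2) ^ m)"

lemma dyadic_sum_const_pos:
  assumes "0 < s" "s < real m"
  shows "0 < dyadic_sum_const m s"
proof -
  have "2 powr (- s) < 1" using assms(1) by (simp add: powr_less_one)
  then show ?thesis
    using half_power_less_two_powr[OF assms(2)] by (simp add: dyadic_sum_const_def add_pos_pos)
qed

lemma ex_dyadic_scale:
  fixes y :: real
  assumes "0 < y" "y \<le> 1"
  shows "\<exists>J. (1/2) ^ Suc J < y \<and> y \<le> (1/2) ^ J"
proof -
  obtain n where "(1/2) ^ n < y" using real_arch_pow_inv[OF assms(1), of "1/2"] by auto
  moreover have "\<not> (1/2) ^ 0 < y" using assms(2) by simp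
  ultimately obtain J where "\<forall>i\<le>J. \<not> (1/2) ^ i < y" "(1/2) ^ Suc J < y"
    using ex_least_nat_less[of "\<lambda>n. (1/2) ^ n < y" n] by blast
  then show ?thesis by (meson not_less order_refl)
qed

lemma sum_dyadic_coarse_le:
  fixes y :: real
  assumes s: "s < real m" and y: "0 \<le> y" "y \<le> (1/2) ^ J"
  shows "(\<Sum>j<Suc J. (2 powr (- s)) ^ j * min 1 ((2 ^ j * y) ^ m))
    \<le> (2 powr (- s)) ^ Suc J / (2 powr (- s) - (1/2) ^ m)"
proof -
  let ?p = "2 powr (- s)" and ?d = "(1/2::real) ^ m"
  have d_less: "?d < ?p" by (rule half_power_less_two_powr[OF s])
  have "(\<Sum>j<Suc J. ?p ^ j * min 1 ((2 ^ j * y) ^ m)) \<le> (\<Sum>j<Suc J. ?p ^ j * ?d ^ (Suc J - j) / ?d)"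
  proof (rule sum_mono)
    fix j assume "j \<in> {..<Suc J}"
    then have j: "j \<le> J" by simp
    have "2 ^ j * y \<le> 2 ^ j * (1/2) ^ J" using y by simp
    also have "\<dots> = (1/2) ^ (J - j)" using j by (simp add: power_diff power_one_over)
    finally have "(2 ^ j * y) ^ m \<le> ((1/2) ^ (J - j)) ^ m" using y by (intro power_mono) auto
    also have "\<dots> = ?d ^ (Suc J - j) / ?d"
      using j by (simp add: Suc_diff_le mult.commute flip: power_mult)
    finally have "min 1 ((2 ^ j * y) ^ m) \<le> ?d ^ (Suc J - j) / ?d" by linarith
    then show "?p ^ j * min 1 ((2 ^ j * y) ^ m) \<le> ?p ^ j * ?d ^ (Suc J - j) / ?d"
      by (simp add: mult_left_mono flip: times_divide_eq_right)
  qed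
  also have "\<dots> = (\<Sum>j<Suc J. ?p ^ j * ?d ^ (Suc J - j)) / ?d" by (simp only: sum_divide_distrib)
  also have "\<dots> \<le> (?p ^ Suc J * (?d / (?p - ?d))) / ?d"
    using d_less by (intro divide_right_mono geometric_convolution_le) auto
  finally show ?thesis by simp
qed

lemma
  fixes y :: real
  assumes s: "0 < s" "s < real m" and y: "0 < y" "y \<le> 1"
  shows summable_dyadic: "summable (\<lambda>j. (2 powr (- s)) ^ j * min 1 ((2 ^ j * y) ^ m))"
    and suminf_dyadic_le:
      "(\<Sum>j. (2 powr (- s)) ^ j * min 1 ((2 ^ j * y) ^ m)) \<le> dyadic_sum_const m s * y powr s"
proof -
  let ?p = "2 powr (- s)" and ?d = "(1/2::real) ^ m"
  let ?a = "\<lambda>j. ?p ^ j * min 1 ((2 ^ j * y) ^ m)"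
  have p: "?p < 1" using s by (simp add: powr_less_one)
  then have geometric: "summable (\<lambda>j. ?p ^ j)" by (simp add: summable_geometric)
  have le_geometric: "?a j \<le> ?p ^ j" for j by (simp add: mult_left_le)
  show summable: "summable ?a"
    by (rule summable_comparison_test'[OF geometric, of 0]) (use y le_geometric in auto)
  obtain J where J: "(1/2) ^ Suc J < y" "y \<le> (1/2) ^ J" using ex_dyadic_scale[OF y] by blast
  have "(\<Sum>j. ?a (j + Suc J)) \<le> (\<Sum>j. ?p ^ (j + Suc J))"
    by (intro suminf_le le_geometric summable_ignore_initial_segment summable geometric)
  also have "\<dots> = (\<Sum>j. ?p ^ j * ?p ^ Suc J)" by (simp only: power_add)
  also have "\<dots> = ?p ^ Suc J / (1 - ?p)"
    using p by (subst suminf_mult2[OF geometric, symmetric]) (simp add: suminf_geometric)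
  finally have fine: "(\<Sum>j. ?a (j + Suc J)) \<le> ?p ^ Suc J / (1 - ?p)" .
  have "suminf ?a = (\<Sum>j. ?a (j + Suc J)) + (\<Sum>j<Suc J. ?a j)"
    by (rule suminf_split_initial_segment[OF summable])
  also have "\<dots> \<le> ?p ^ Suc J / (1 - ?p) + ?p ^ Suc J / (?p - ?d)"
    using y(1) J(2) by (intro add_mono fine sum_dyadic_coarse_le s) auto
  also have "\<dots> = dyadic_sum_const m s * ?p ^ Suc J"
    by (simp add: dyadic_sum_const_def algebra_simps)
  also have "\<dots> \<le> dyadic_sum_const m s * y powr s"
  proof (rule mult_left_mono[OF _ less_imp_le[OF dyadic_sum_const_pos[OF s]]])
    show "?p ^ Suc J \<le> y powr s"
      unfolding half_power_powr[symmetric] using J(1) s by (intro powr_mono2) auto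
  qed
  finally show "suminf ?a \<le> dyadic_sum_const m s * y powr s" .
qed

lemma abs_diffk_suminf_le:
  fixes g :: "nat \<Rightarrow> real^'n \<Rightarrow> real"
  assumes s: "0 < s" "s < real m" and A: "0 \<le> A" and h: "0 < norm h" "norm h \<le> 1"
    and summable: "\<And>x. summable (\<lambda>j. g j x)"
    and diff: "\<And>j. \<bar>diffk m h (g j) x\<bar> \<le> A * (2 powr (- s)) ^ j * min 1 ((2 ^ j * norm h) ^ m)"
  shows "\<bar>diffk m h (\<lambda>x. \<Sum>j. g j x) x\<bar> \<le> dyadic_sum_const m s * A * norm h powr s"
proof -
  let ?a = "\<lambda>j. (2 powr (- s)) ^ j * min 1 ((2 ^ j * norm h) ^ m)"
  note dyadic = summable_dyadic[OF s h]
  have "diffk m h (\<lambda>x. \<Sum>j. g j x) x = (\<Sum>j. diffk m h (g j) x)"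
    by (intro sums_unique diffk_sums summable_sums summable)
  also have "\<bar>\<dots>\<bar> \<le> (\<Sum>j. A * ?a j)"
    unfolding real_norm_def[symmetric]
    by (rule norm_suminf_le[OF _ summable_mult[OF dyadic]]) (use diff in \<open>simp add: mult.assoc\<close>)
  also have "\<dots> = A * suminf ?a" by (rule suminf_mult[OF dyadic])
  also have "\<dots> \<le> A * (dyadic_sum_const m s * norm h powr s)"
    by (rule mult_left_mono[OF suminf_dyadic_le[OF s h] A])
  finally show ?thesis by (simp add: mult_ac)
qed

lemma continuous_on_suminf:
  fixes g :: "nat \<Rightarrow> 'a::topological_space \<Rightarrow> 'b::banach"
  assumes "\<And>j. continuous_on X (g j)" "\<And>j x. x \<in> X \<Longrightarrow> norm (g j x) \<le> G j" "summable G"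
  shows "continuous_on X (\<lambda>x. \<Sum>j. g j x)"
proof -
  have "uniform_limit X (\<lambda>n x. \<Sum>i<n. g i x) (\<lambda>x. \<Sum>j. g j x) sequentially"
    using assms(2,3) by (rule Weierstrass_m_test)
  then show ?thesis
    by (rule uniform_limit_theorem[rotated])
      (auto intro!: always_eventually continuous_on_sum assms(1))
qed

lemma lip_bound_suminf:
  fixes g :: "nat \<Rightarrow> real^'n \<Rightarrow> real"
  assumes s: "0 < s" "s < real m" and A: "0 \<le> A"
    and continuous: "\<And>j. continuous_on UNIV (g j)"
    and size: "\<And>j x. \<bar>g j x\<bar> \<le> A * (2 powr (- s)) ^ j"
    and diff: "\<And>j h x. \<bar>diffk m h (g j) x\<bar> \<le> A * (2 powr (- s)) ^ j * min 1 ((2 ^ j * norm h) ^ m)"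
  shows "lip_bound m s (dyadic_sum_const m s * A) (\<lambda>x. \<Sum>j. g j x)"
  unfolding lip_bound_def
proof (intro conjI allI impI)
  let ?p = "2 powr (- s)"
  have p: "?p < 1" using s by (simp add: powr_less_one)
  have majorant: "(\<lambda>j. A * ?p ^ j) sums (A * (1 / (1 - ?p)))"
    using p by (intro sums_mult geometric_sums) simp
  show "continuous_on UNIV (\<lambda>x. \<Sum>j. g j x)"
    by (rule continuous_on_suminf[OF continuous _ sums_summable[OF majorant]]) (simp add: size)
  show "\<bar>\<Sum>j. g j x\<bar> \<le> dyadic_sum_const m s * A" for x
  proof -
    have "\<bar>\<Sum>j. g j x\<bar> \<le> (\<Sum>j. A * ?p ^ j)"
      unfolding real_norm_def[symmetric]
      by (rule norm_suminf_le[OF _ sums_summable[OF majorant]]) (use size in simp)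
    also have "\<dots> = A * (1 / (1 - ?p))" by (rule sums_unique[OF majorant, symmetric])
    also have "\<dots> \<le> A * dyadic_sum_const m s"
      using A half_power_less_two_powr[OF s(2)]
      by (intro mult_left_mono) (auto simp: dyadic_sum_const_def)
    finally show ?thesis by (simp add: mult.commute)
  qed
  have "summable (\<lambda>j. g j x)" for x
    by (rule summable_comparison_test'[OF sums_summable[OF majorant], of 0]) (use size in auto)
  then show "\<bar>diffk m h (\<lambda>x. \<Sum>j. g j x) x\<bar> \<le> dyadic_sum_const m s * A * norm h powr s"
    if "0 < norm h" "norm h \<le> 1" for h x
    using diff by (intro abs_diffk_suminf_le[OF s A that])
qed

section \<open>Dyadic cubes and coefficient families\<close>

definition cube_index :: "nat \<Rightarrow> real^'n \<Rightarrow> int^'n" where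
  "cube_index j x = (\<chi> i. \<lfloor>2 ^ j * x $ i\<rfloor>)"

lemma mem_dcube_iff: "x \<in> dcube j k \<longleftrightarrow> k = cube_index j x"
proof -
  have "(real_of_int (k $ i) / 2 ^ j \<le> x $ i \<and> x $ i < (real_of_int (k $ i) + 1) / 2 ^ j)
      \<longleftrightarrow> k $ i = \<lfloor>2 ^ j * x $ i\<rfloor>" for i
    by (simp add: divide_le_eq less_divide_eq eq_commute[of "k $ i"] floor_eq_iff mult.commute)
  then show ?thesis by (simp add: dcube_def cube_index_def vec_eq_iff)
qed

lemma measurable_cube_index: "cube_index j \<in> borel \<rightarrow>\<^sub>M count_space UNIV"
proof (subst measurable_count_space_eq2_countable, intro conjI ballI)
  fix k :: "int^'a"
  have "cube_index j -` {k} \<inter> space borel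
      = (\<Inter>i. {x. real_of_int (k $ i) / 2 ^ j \<le> x $ i \<and> x $ i < (real_of_int (k $ i) + 1) / 2 ^ j})"
    using mem_dcube_iff[of _ j k] by (auto simp: dcube_def)
  moreover have "{x::real^'a. real_of_int (k $ i) / 2 ^ j \<le> x $ i \<and>
      x $ i < (real_of_int (k $ i) + 1) / 2 ^ j} \<in> sets borel" for i
    by measurable
  ultimately show "cube_index j -` {k} \<inter> space borel \<in> sets borel"
    by (auto intro: sets.finite_INT)
qed auto

lemma adm_seq_cube_index: "adm_seq (\<lambda>j x. F j (cube_index j x))"
  unfolding adm_seq_def
proof
  fix j
  have "(\<lambda>x. F j (cube_index j x)) \<in> borel_measurable borel"
    by (rule measurable_compose[OF measurable_cube_index]) simp
  then show "(\<lambda>x. F j (cube_index j x)) \<in> borel_measurable lebesgue"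
    by (simp add: measurable_completion)
qed

lemma cube_vol_eq: "cube_vol j (k :: int^'n) = 2 powr (- (real j * real CARD('n)))"
proof -
  let ?a = "(\<chi> i. real_of_int (k $ i) / 2 ^ j) :: real^'n"
  let ?b = "(\<chi> i. (real_of_int (k $ i) + 1) / 2 ^ j) :: real^'n"
  have order: "?a $ i \<le> ?b $ i" for i by (simp add: divide_right_mono)
  have sandwich: "box ?a ?b \<subseteq> dcube j k" "dcube j k \<subseteq> cbox ?a ?b"
    by (auto simp: dcube_def mem_box_cart less_imp_le)
  have "?a \<bullet> b \<le> ?b \<bullet> b" if "b \<in> Basis" for b
    using that order by (auto simp: Basis_vec_def inner_axis)
  then have "emeasure lborel (box ?a ?b) = emeasure lborel (cbox ?a ?b)"
    by (simp add: emeasure_lborel_box emeasure_lborel_cbox)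
  moreover have "dcube j k = cube_index j -` {k} \<inter> space borel"
    by (auto simp: mem_dcube_iff)
  then have "dcube j k \<in> sets borel"
    using measurable_sets[OF measurable_cube_index, of "{k}" j] by simp
  then have "emeasure lborel (box ?a ?b) \<le> emeasure lborel (dcube j k)"
    "emeasure lborel (dcube j k) \<le> emeasure lborel (cbox ?a ?b)"
    using sandwich by (auto intro!: emeasure_mono)
  ultimately have "cube_vol j k = measure lborel (cbox ?a ?b)"
    by (simp add: cube_vol_def measure_def)
  also have "\<dots> = (\<Prod>i\<in>(UNIV::'n set). 1 / 2 ^ j)"
    using order
    by (subst content_cbox_cart) (auto simp: interval_ne_empty_cart diff_divide_distrib[symmetric])
  also have "\<dots> = 2 powr (- (real j * real CARD('n)))"
    by (simp add: powr_minus power_one_over inverse_eq_divide powr_powr flip: powr_realpow)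
  finally show ?thesis .
qed

definition generator :: "(real^'n \<Rightarrow> real) \<Rightarrow> (nat \<Rightarrow> real^'n \<Rightarrow> real) \<Rightarrow> nat \<Rightarrow> real^'n \<Rightarrow> real" where
  "generator \<phi> \<psi> l = (if l = 0 then \<phi> else \<psi> l)"

definition generator_indices :: "nat \<Rightarrow> nat \<Rightarrow> nat set" where
  "generator_indices n j = (if j = 0 then {0} else {}) \<union> {1..2 ^ n - 1}"

lemma finite_generator_indices: "finite (generator_indices n j)"
  and generator_indices_le: "l \<in> generator_indices n j \<Longrightarrow> l \<le> 2 ^ n - 1"
  and one_in_generator_indices: "0 < n \<Longrightarrow> 1 \<in> generator_indices n j"
  using one_less_power[of "2::nat" n] by (auto simp: generator_indices_def split: if_splits)

lemma card_generator_indices_le: "real (card (generator_indices n j)) \<le> 2 ^ n"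
proof -
  have "generator_indices n j \<subseteq> {..2 ^ n - 1}" using generator_indices_le by auto
  then have "card (generator_indices n j) \<le> 2 ^ n"
    using card_mono[of "{..2 ^ n - 1}" "generator_indices n j"] by simp
  from of_nat_mono[OF this, where 'a = real] show ?thesis by simp
qed

lemma Omega_iff: "(l, j, k :: int^'n) \<in> Omega \<longleftrightarrow> l \<in> generator_indices CARD('n) j"
  by (auto simp: Omega_def generator_indices_def)

lemma wav_eq:
  assumes "(l, j, k :: int^'n) \<in> Omega"
  shows "wav \<phi> \<psi> (l, j, k) x
    = 2 powr (real j * real CARD('n) / 2) * generator \<phi> \<psi> l (2 ^ j *\<^sub>R x - ivec k)"
  using assms by (auto simp: wav_def generator_def Omega_def)

definition weighted_abs ::
    "real \<Rightarrow> (nat \<times> nat \<times> (int^'n) \<Rightarrow> real) \<Rightarrow> nat \<times> nat \<times> (int^'n) \<Rightarrow> real" where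
  "weighted_abs s c \<omega> = cube_vol (fst (snd \<omega>)) (snd (snd \<omega>)) powr (- s / real CARD('n) - 1/2) * \<bar>c \<omega>\<bar>"

lemma weighted_abs_nonneg: "0 \<le> weighted_abs s c \<omega>"
  by (simp add: weighted_abs_def)

lemma weighted_abs_le_iff:
  fixes c :: "nat \<times> nat \<times> (int^'n) \<Rightarrow> real"
  shows "weighted_abs s c (l, j, k) \<le> \<epsilon> \<longleftrightarrow>
    \<bar>2 powr (real j * real CARD('n) / 2) * c (l, j, k)\<bar> \<le> \<epsilon> * (2 powr (- s)) ^ j"
proof -
  have decay: "(2 powr (- s)) ^ j = 2 powr (- (s * real j))" by (simp add: powr_powr flip: powr_realpow)
  have "- (real j * real CARD('n)) * (- s / real CARD('n) - 1/2)
      = real j * real CARD('n) / 2 - (- (s * real j))"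
    by (simp add: field_simps)
  then have "cube_vol j k powr (- s / real CARD('n) - 1/2)
      = 2 powr (real j * real CARD('n) / 2) / (2 powr (- s)) ^ j"
    unfolding cube_vol_eq powr_powr decay by (simp only: powr_diff)
  then show ?thesis by (simp add: weighted_abs_def divide_le_eq abs_mult)
qed

lemma wseq_eq:
  "wseq s \<phi> \<psi> f j (x :: real^'n)
    = (\<Sum>l\<in>generator_indices CARD('n) j. weighted_abs s (coef \<phi> \<psi> f) (l, j, cube_index j x))"
proof -
  let ?k = "cube_index j x" and ?G = "generator_indices CARD('n) j"
  let ?F = "\<lambda>\<omega>. cube_vol j (snd (snd \<omega>)) powr (- s / real CARD('n) - 1/2) * \<bar>coef \<phi> \<psi> f \<omega>\<bar>
      * indicator (dcube j (snd (snd \<omega>))) x :: real"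
  have "wseq s \<phi> \<psi> f j x = infsum ?F ((\<lambda>l. (l, j, ?k)) ` ?G)"
    unfolding wseq_def
    by (rule infsum_cong_neutral) (auto simp: indicator_def mem_dcube_iff Omega_iff image_iff)
  also have "\<dots> = (\<Sum>l\<in>?G. ?F (l, j, ?k))"
    by (subst infsum_finite, simp add: finite_generator_indices, subst sum.reindex)
      (auto simp: inj_on_def)
  finally show ?thesis by (simp add: weighted_abs_def mem_dcube_iff)
qed

lemma W0_iff:
  "k \<in> W0 \<phi> \<psi> s f \<epsilon> j \<longleftrightarrow>
    (\<exists>l\<in>generator_indices CARD('n) j. \<epsilon> < weighted_abs s (coef \<phi> \<psi> f) (l, j, k :: int^'n))"
proof -
  let ?S = "(\<lambda>l. \<bar>coef \<phi> \<psi> f (l, j, k)\<bar>) ` generator_indices CARD('n) j"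
  have "{\<bar>coef \<phi> \<psi> f \<omega>\<bar> |\<omega>. \<omega> \<in> Omega \<and> fst (snd \<omega>) = j \<and> snd (snd \<omega>) = k} = ?S"
    by (auto simp: Omega_iff image_iff)
  moreover have "?S \<noteq> {}" using one_in_generator_indices[of "CARD('n)" j] by auto
  ultimately have "k \<in> W0 \<phi> \<psi> s f \<epsilon> j \<longleftrightarrow>
      (\<exists>l\<in>generator_indices CARD('n) j.
        \<epsilon> * cube_vol j k powr (s / real CARD('n) + 1/2) < \<bar>coef \<phi> \<psi> f (l, j, k)\<bar>)"
    by (simp add: W0_def Max_gr_iff finite_generator_indices)
  moreover have "cube_vol j k powr (- s / real CARD('n) - 1/2)
      = 1 / cube_vol j k powr (s / real CARD('n) + 1/2)"
    by (simp flip: powr_minus_divide)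
  moreover have "0 < cube_vol j k" by (simp add: cube_vol_eq)
  ultimately show ?thesis by (simp add: weighted_abs_def less_divide_eq)
qed

lemma W0_seq_eq: "W0_seq \<phi> \<psi> s f \<epsilon> j x = (if cube_index j x \<in> W0 \<phi> \<psi> s f \<epsilon> j then 1 else 0)"
proof -
  have "W0_seq \<phi> \<psi> s f \<epsilon> j x = infsum (\<lambda>k. indicator (dcube j k) x) (W0 \<phi> \<psi> s f \<epsilon> j \<inter> {cube_index j x})"
    unfolding W0_seq_def by (rule infsum_cong_neutral) (auto simp: indicator_def mem_dcube_iff)
  then show ?thesis by (auto simp: mem_dcube_iff)
qed

lemma adm_seq_wseq: "adm_seq (wseq s \<phi> \<psi> f)"
  using adm_seq_cube_index[of "\<lambda>j k. \<Sum>l\<in>generator_indices CARD('a) j.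
    weighted_abs s (coef \<phi> \<psi> f) (l, j, k)"]
  by (simp add: wseq_eq[abs_def])

lemma adm_seq_W0_seq: "adm_seq (W0_seq \<phi> \<psi> s f \<epsilon>)"
  using adm_seq_cube_index[of "\<lambda>j k. if k \<in> W0 \<phi> \<psi> s f \<epsilon> j then 1 else 0"]
  by (simp add: W0_seq_eq[abs_def])

section \<open>Analysis and synthesis\<close>

locale wavelet_system =
  fixes \<phi> :: "real^'n \<Rightarrow> real" and \<psi> :: "nat \<Rightarrow> real^'n \<Rightarrow> real" and m L :: nat and R M :: real
  assumes bump_generator: "l \<le> 2 ^ CARD('n) - 1 \<Longrightarrow> bump m R M (generator \<phi> \<psi> l)"
    and moments: "1 \<le> l \<Longrightarrow> l \<le> 2 ^ CARD('n) - 1 \<Longrightarrow> vanishing_moments L (generator \<phi> \<psi> l)"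
    and orthonormal: "\<omega> \<in> Omega \<Longrightarrow> \<omega>' \<in> Omega \<Longrightarrow>
      (LINT x|lborel. wav \<phi> \<psi> \<omega> x * wav \<phi> \<psi> \<omega>' x) = (if \<omega> = \<omega>' then 1 else 0)"
    and order_le: "m \<le> L"
begin

lemma bump_generator_if_Omega: "(l, j, k :: int^'n) \<in> Omega \<Longrightarrow> bump m R M (generator \<phi> \<psi> l)"
  unfolding Omega_iff by (rule bump_generator[OF generator_indices_le])

sublocale \<phi>: bump m R M \<phi>
  using bump_generator[of 0] by (simp add: generator_def)

lemma continuous_on_wav:
  assumes "\<omega> \<in> Omega"
  shows "continuous_on UNIV (wav \<phi> \<psi> \<omega>)"
proof -
  obtain l j k where \<omega>: "\<omega> = (l, j, k)" by (cases \<omega>) auto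
  interpret bump m R M "generator \<phi> \<psi> l" using assms \<omega> by (auto intro: bump_generator_if_Omega)
  show ?thesis
    unfolding \<omega> wav_eq[OF assms[unfolded \<omega>], abs_def]
    by (intro continuous_intros continuous_on_compose2[OF continuous]) auto
qed

lemma vanishes_outside_wav:
  assumes "\<omega> \<in> Omega"
  shows "vanishes_outside (R + norm (ivec (snd (snd \<omega>)))) (wav \<phi> \<psi> \<omega>)"
  unfolding vanishes_outside_def
proof (intro allI impI)
  fix x :: "real^'n" assume x: "R + norm (ivec (snd (snd \<omega>))) < norm x"
  obtain l j k where \<omega>: "\<omega> = (l, j, k)" by (cases \<omega>) auto
  interpret bump m R M "generator \<phi> \<psi> l" using assms \<omega> by (auto intro: bump_generator_if_Omega)
  have "1 * norm x \<le> 2 ^ j * norm x" by (intro mult_right_mono) auto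
  then have "R < norm (2 ^ j *\<^sub>R x - ivec k)"
    using norm_triangle_ineq2[of "2 ^ j *\<^sub>R x" "ivec k"] x \<omega> by simp
  then show "wav \<phi> \<psi> \<omega> x = 0"
    using wav_eq[OF assms[unfolded \<omega>]] vanishes_outsideD[OF vanishes] \<omega> by simp
qed

lemma integrable_wav: "\<omega> \<in> Omega \<Longrightarrow> integrable lborel (wav \<phi> \<psi> \<omega>)"
  by (rule integrable_if_vanishes_outside[OF continuous_on_wav vanishes_outside_wav])

lemma integrable_wav_mult_wav:
  "\<omega> \<in> Omega \<Longrightarrow> \<omega>' \<in> Omega \<Longrightarrow> integrable lborel (\<lambda>x. wav \<phi> \<psi> \<omega>' x * wav \<phi> \<psi> \<omega> x)"
  by (rule integrable_if_vanishes_outside[OF continuous_on_mult[OF continuous_on_wav continuous_on_wav]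
        vanishes_outside_mult[OF vanishes_outside_wav]])

lemma coef_eq_kernel_avg:
  assumes f: "bounded_borel B f" and \<omega>: "(l, j, k) \<in> Omega"
  shows "2 powr (real j * real CARD('n) / 2) * coef \<phi> \<psi> f (l, j, k)
    = kernel_avg (generator \<phi> \<psi> l) ((1/2) ^ j) f ((1/2) ^ j *\<^sub>R ivec k)"
proof -
  let ?c = "(1/2::real) ^ j" and ?a = "2 powr (real j * real CARD('n) / 2)"
  let ?I = "kernel_avg (generator \<phi> \<psi> l) ?c f (?c *\<^sub>R ivec k)"
  have [measurable]: "f \<in> borel_measurable borel" "wav \<phi> \<psi> (l, j, k) \<in> borel_measurable borel"
    using bounded_borel_measurable[OF f] borel_measurable_continuous_onI[OF continuous_on_wav[OF \<omega>]]
    by auto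
  have "2 ^ j *\<^sub>R (?c *\<^sub>R ivec k + ?c *\<^sub>R z) - ivec k = z" for z :: "real^'n"
    by (simp add: scaleR_add_right power_one_over)
  then have wav: "wav \<phi> \<psi> (l, j, k) (?c *\<^sub>R ivec k + ?c *\<^sub>R z) = ?a * generator \<phi> \<psi> l z" for z
    by (simp add: wav_eq[OF \<omega>])
  have "coef \<phi> \<psi> f (l, j, k) = \<bar>?c\<bar> ^ CARD('n) * (LINT z|lborel.
      f (?c *\<^sub>R ivec k + ?c *\<^sub>R z) * wav \<phi> \<psi> (l, j, k) (?c *\<^sub>R ivec k + ?c *\<^sub>R z))"
    unfolding coef_def by (subst lborel_integral_affine[where c = ?c and t = "?c *\<^sub>R ivec k"]) auto
  also have "\<dots> = \<bar>?c\<bar> ^ CARD('n) * (?a * ?I)"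
    unfolding wav kernel_avg_def by (simp add: mult.left_commute[of "f _"])
  finally have "?a * coef \<phi> \<psi> f (l, j, k) = (?a * ?a * \<bar>?c\<bar> ^ CARD('n)) * ?I"
    by (simp only: mult_ac)
  moreover have "?a * ?a = 2 ^ (j * CARD('n))" by (simp flip: powr_add powr_realpow)
  then have "?a * ?a * \<bar>?c\<bar> ^ CARD('n) = 1"
    by (simp add: power_one_over flip: power_mult)
  ultimately show ?thesis by simp
qed

lemma ex_approximation_kernel_wavelet:
  assumes s: "0 < s" "s < real m"
  shows "\<exists>R' M' (K :: real^'n \<Rightarrow> real) E. approximation_kernel m R' M' K s E"
proof -
  obtain R' M' where "bump m R' M' (\<lambda>x. \<phi> x * \<phi> x)"
    using ex_bump[OF Ck_mult[OF \<phi>.smooth \<phi>.smooth] vanishes_outside_mult[OF \<phi>.vanishes]] by blast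
  then interpret square: bump m R' M' "\<lambda>x. \<phi> x * \<phi> x" .
  have "(0, 0, 0 :: int^'n) \<in> Omega" by (simp add: Omega_def)
  from orthonormal[OF this this] have "(LINT x|lborel. \<phi> x * \<phi> x) = 1"
    by (simp add: wav_def ivec_def zero_vec_def[symmetric])
  from square.ex_approximation_kernel[OF this s] show ?thesis .
qed

lemma ex_decay_const:
  assumes s: "0 < s" "s < real m"
  shows "\<exists>D\<ge>0. \<forall>l f B j a. 1 \<le> l \<longrightarrow> l \<le> 2 ^ CARD('n) - 1 \<longrightarrow> bounded_borel B f \<longrightarrow>
    diff_bound m s B f \<longrightarrow> \<bar>kernel_avg (generator \<phi> \<psi> l) ((1/2) ^ j) f a\<bar> \<le> D * B * (2 powr (- s)) ^ j"
proof -
  obtain R' M' E and K :: "real^'n \<Rightarrow> real" where "approximation_kernel m R' M' K s E"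
    using ex_approximation_kernel_wavelet[OF s] by blast
  then interpret K: approximation_kernel m R' M' K s E .
  have "\<bar>kernel_avg (generator \<phi> \<psi> l) ((1/2) ^ j) f a\<bar> \<le> K.decay_const R M * B * (2 powr (- s)) ^ j"
    if "1 \<le> l" "l \<le> 2 ^ CARD('n) - 1" "bounded_borel B f" "diff_bound m s B f" for l f B j a
    using K.abs_kernel_avg_vanishing_moments_le[OF bump_generator moments _ that(3,4)] that(1,2) order_le
    by simp
  then show ?thesis
    using K.decay_const_nonneg[OF \<phi>.radius_pos \<phi>.bound_pos]
    by (intro exI[of _ "K.decay_const R M"]) simp
qed

theorem ex_analysis_const:
  assumes s: "0 < s" "s < real m"
  shows "\<exists>A>0. \<forall>f B \<omega>. lip_bound m s B f \<longrightarrow> \<omega> \<in> Omega \<longrightarrow> weighted_abs s (coef \<phi> \<psi> f) \<omega> \<le> A * B"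
proof -
  obtain D where D: "0 \<le> D" and decay: "\<And>l f B j a. 1 \<le> l \<Longrightarrow> l \<le> 2 ^ CARD('n) - 1 \<Longrightarrow>
      bounded_borel B f \<Longrightarrow> diff_bound m s B f \<Longrightarrow>
      \<bar>kernel_avg (generator \<phi> \<psi> l) ((1/2) ^ j) f a\<bar> \<le> D * B * (2 powr (- s)) ^ j"
    using ex_decay_const[OF s] by metis
  have "weighted_abs s (coef \<phi> \<psi> f) \<omega> \<le> (M + D * 2 ^ m) * B"
    if f: "lip_bound m s B f" and \<omega>: "\<omega> \<in> Omega" for f B \<omega>
  proof -
    obtain l j k where ljk: "\<omega> = (l, j, k)" by (cases \<omega>) auto
    note Omega = \<omega>[unfolded ljk]
    have B: "0 \<le> B" by (rule lip_bound_nonneg[OF f])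
    note bounded = lip_bound_imp_bounded_borel[OF f]
    let ?I = "kernel_avg (generator \<phi> \<psi> l) ((1/2) ^ j) f ((1/2) ^ j *\<^sub>R ivec k)"
    have "\<bar>?I\<bar> \<le> (M + D * 2 ^ m) * B * (2 powr (- s)) ^ j"
    proof (cases "l = 0")
      case True
      then have "j = 0" using Omega by (simp add: Omega_def)
      moreover have "\<bar>?I\<bar> \<le> M * B"
        using bump.abs_kernel_avg_le[OF bump_generator_if_Omega[OF Omega] bounded]
        by (simp add: mult.commute)
      ultimately show ?thesis using D B by (simp add: distrib_right add_increasing2)
    next
      case False
      have "bounded_borel (2 ^ m * B) f"
        using bounded B by (auto simp: bounded_borel_def mult_le_cancel_right1 intro: order_trans)
      moreover have "diff_bound m s (2 ^ m * B) f" using lip_bound_imp_diff_bound[OF f] s by simp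
      moreover have "1 \<le> l" "l \<le> 2 ^ CARD('n) - 1"
        using False generator_indices_le[of l "CARD('n)" j] Omega by (simp_all add: Omega_iff)
      ultimately have "\<bar>?I\<bar> \<le> D * (2 ^ m * B) * (2 powr (- s)) ^ j" by (intro decay)
      also have "\<dots> \<le> (M + D * 2 ^ m) * B * (2 powr (- s)) ^ j"
        using \<phi>.bound_pos B by (intro mult_right_mono) (auto simp: algebra_simps)
      finally show ?thesis .
    qed
    then show ?thesis
      unfolding ljk weighted_abs_le_iff coef_eq_kernel_avg[OF bounded Omega] .
  qed
  then show ?thesis using D \<phi>.bound_pos by (intro exI[of _ "M + D * 2 ^ m"]) (auto intro: add_pos_nonneg)
qed

definition synth_level :: "(nat \<times> nat \<times> (int^'n) \<Rightarrow> real) \<Rightarrow> nat \<Rightarrow> real^'n \<Rightarrow> real" where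
  "synth_level c j x = (\<Sum>l\<in>generator_indices CARD('n) j. lattice_sum (generator \<phi> \<psi> l)
     (\<lambda>k. 2 powr (real j * real CARD('n) / 2) * c (l, j, k)) (2 ^ j *\<^sub>R x))"

definition synth :: "(nat \<times> nat \<times> (int^'n) \<Rightarrow> real) \<Rightarrow> real^'n \<Rightarrow> real" where
  "synth c x = (\<Sum>j. synth_level c j x)"

definition level_const :: real where
  "level_const = 2 ^ CARD('n) * lattice_const CARD('n) m R M"

lemma level_const_pos: "0 < level_const"
  using lattice_const_pos[of "CARD('n)" M m R] \<phi>.bound_pos by (simp add: level_const_def)

lemma continuous_on_synth_level: "continuous_on UNIV (synth_level c j)"
proof -
  have "continuous_on UNIV (\<lambda>x. lattice_sum (generator \<phi> \<psi> l) d (2 ^ j *\<^sub>R x))"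
    if l: "l \<in> generator_indices CARD('n) j" for l d
  proof -
    interpret bump m R M "generator \<phi> \<psi> l" by (rule bump_generator[OF generator_indices_le[OF l]])
    show ?thesis
      by (intro continuous_on_compose2[OF continuous_on_lattice_sum[OF continuous vanishes]]
          continuous_intros) auto
  qed
  then show ?thesis unfolding synth_level_def[abs_def] by (intro continuous_on_sum)
qed

lemma
  assumes c: "\<And>\<omega>. \<omega> \<in> Omega \<Longrightarrow> weighted_abs s c \<omega> \<le> \<epsilon>" and \<epsilon>: "0 \<le> \<epsilon>"
  shows abs_synth_level_le: "\<bar>synth_level c j x\<bar> \<le> level_const * \<epsilon> * (2 powr (- s)) ^ j"
    and abs_diffk_synth_level_le:
      "\<bar>diffk m h (synth_level c j) x\<bar>
        \<le> level_const * \<epsilon> * (2 powr (- s)) ^ j * min 1 ((2 ^ j * norm h) ^ m)"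
proof -
  let ?G = "generator_indices CARD('n) j"
  let ?b = "lattice_const CARD('n) m R M * (\<epsilon> * (2 powr (- s)) ^ j)"
  let ?d = "\<lambda>l k. 2 powr (real j * real CARD('n) / 2) * c (l, j, k)"
  have bump: "bump m R M (generator \<phi> \<psi> l)" if "l \<in> ?G" for l
    by (rule bump_generator[OF generator_indices_le[OF that]])
  have scaled_le: "\<bar>?d l k\<bar> \<le> \<epsilon> * (2 powr (- s)) ^ j" if "l \<in> ?G" for l k
    using c[of "(l, j, k)"] that by (simp only: Omega_iff weighted_abs_le_iff)
  have bound_nonneg: "0 \<le> ?b" using \<epsilon> lattice_const_pos[of "CARD('n)" M m R] \<phi>.bound_pos by simp
  have card: "real (card ?G) * (?b * t) \<le> level_const * \<epsilon> * (2 powr (- s)) ^ j * t" if "0 \<le> t" for t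
    using mult_right_mono[OF card_generator_indices_le[of "CARD('n)" j]
        mult_nonneg_nonneg[OF bound_nonneg that]]
    by (simp add: level_const_def mult.assoc)
  have "\<bar>synth_level c j x\<bar> \<le> (\<Sum>l\<in>?G. ?b)"
    unfolding synth_level_def
    by (intro order_trans[OF sum_abs] sum_mono bump.abs_lattice_sum_bump_le[OF bump scaled_le])
  then show "\<bar>synth_level c j x\<bar> \<le> level_const * \<epsilon> * (2 powr (- s)) ^ j"
    using card[of 1] by simp
  have "\<bar>diffk m h (synth_level c j) x\<bar> \<le> (\<Sum>l\<in>?G. ?b * min 1 (norm ((2 ^ j :: real) *\<^sub>R h) ^ m))"
    unfolding synth_level_def[abs_def] diffk_sum diffk_scaleR
    by (intro order_trans[OF sum_abs] sum_mono bump.abs_diffk_lattice_sum_bump_le[OF bump scaled_le])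
  then show "\<bar>diffk m h (synth_level c j) x\<bar>
      \<le> level_const * \<epsilon> * (2 powr (- s)) ^ j * min 1 ((2 ^ j * norm h) ^ m)"
    using card[of "min 1 ((2 ^ j * norm h) ^ m)"] by simp
qed

lemma lip_bound_synth:
  assumes "0 < s" "s < real m" "0 \<le> \<epsilon>" "\<And>\<omega>. \<omega> \<in> Omega \<Longrightarrow> weighted_abs s c \<omega> \<le> \<epsilon>"
  shows "lip_bound m s (dyadic_sum_const m s * (level_const * \<epsilon>)) (synth c)"
  unfolding synth_def[abs_def]
  using assms level_const_pos
  by (intro lip_bound_suminf continuous_on_synth_level abs_synth_level_le abs_diffk_synth_level_le) auto

lemma synth_level_eq_sum:
  assumes "finite F" "{k. norm (2 ^ j *\<^sub>R x - ivec k) \<le> R} \<subseteq> F"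
  shows "synth_level c j x = (\<Sum>\<omega>\<in>generator_indices CARD('n) j \<times> {j} \<times> F. c \<omega> * wav \<phi> \<psi> \<omega> x)"
proof -
  let ?a = "2 powr (real j * real CARD('n) / 2)"
  have "lattice_sum (generator \<phi> \<psi> l) (\<lambda>k. ?a * c (l, j, k)) (2 ^ j *\<^sub>R x)
      = (\<Sum>k\<in>F. c (l, j, k) * wav \<phi> \<psi> (l, j, k) x)" if l: "l \<in> generator_indices CARD('n) j" for l
  proof -
    interpret bump m R M "generator \<phi> \<psi> l" by (rule bump_generator[OF generator_indices_le[OF l]])
    have "wav \<phi> \<psi> (l, j, k) x = ?a * generator \<phi> \<psi> l (2 ^ j *\<^sub>R x - ivec k)" for k
      using wav_eq Omega_iff l by blast
    then show ?thesis unfolding lattice_sum_eq_sum[OF vanishes assms] by (simp add: mult_ac)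
  qed
  then show ?thesis
    unfolding synth_level_def by (simp add: sum.cartesian_product')
qed

lemma coef_synth_level:
  assumes \<omega>: "\<omega> \<in> Omega"
  shows "coef \<phi> \<psi> (synth_level c j) \<omega> = (if j = fst (snd \<omega>) then c \<omega> else 0)"
proof -
  let ?r = "R + norm (ivec (snd (snd \<omega>)))"
  define F where "F = insert (snd (snd \<omega>)) {k :: int^'n. norm (0 - ivec k) \<le> R + 2 ^ j * ?r}"
  define I where "I = generator_indices CARD('n) j \<times> {j} \<times> F"
  have finite: "finite F" "finite I"
    using finite_lattice_points_cball[of "0 :: real^'n"]
    by (auto simp: F_def I_def finite_generator_indices)
  have I: "I \<subseteq> Omega" by (auto simp: I_def Omega_iff)
  have "synth_level c j x * wav \<phi> \<psi> \<omega> x = (\<Sum>\<omega>'\<in>I. c \<omega>' * (wav \<phi> \<psi> \<omega>' x * wav \<phi> \<psi> \<omega> x))" for x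
  proof (cases "norm x \<le> ?r")
    case True
    have "{k. norm (2 ^ j *\<^sub>R x - ivec k) \<le> R} \<subseteq> F"
    proof clarify
      fix k assume k: "norm (2 ^ j *\<^sub>R x - ivec k) \<le> R"
      have "norm (ivec k) \<le> norm (2 ^ j *\<^sub>R x - ivec k) + norm (2 ^ j *\<^sub>R x)"
        using norm_triangle_ineq4[of "2 ^ j *\<^sub>R x" "2 ^ j *\<^sub>R x - ivec k"] by simp
      also have "\<dots> \<le> R + 2 ^ j * ?r" using True k by (intro add_mono) auto
      finally show "k \<in> F" by (simp add: F_def)
    qed
    from synth_level_eq_sum[OF finite(1) this] show ?thesis
      by (simp add: I_def sum_distrib_right mult.assoc)
  next
    case False
    then show ?thesis using vanishes_outsideD[OF vanishes_outside_wav[OF \<omega>]] by simp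
  qed
  then have "coef \<phi> \<psi> (synth_level c j) \<omega>
      = (LINT x|lborel. (\<Sum>\<omega>'\<in>I. c \<omega>' * (wav \<phi> \<psi> \<omega>' x * wav \<phi> \<psi> \<omega> x)))"
    by (simp only: coef_def)
  also have "\<dots> = (\<Sum>\<omega>'\<in>I. LINT x|lborel. c \<omega>' * (wav \<phi> \<psi> \<omega>' x * wav \<phi> \<psi> \<omega> x))"
    using I \<omega>
    by (intro Bochner_Integration.integral_sum integrable_mult_right integrable_wav_mult_wav) auto
  also have "\<dots> = (\<Sum>\<omega>'\<in>I. if \<omega>' = \<omega> then c \<omega> else 0)"
    using subsetD[OF I] by (intro sum.cong refl) (simp add: orthonormal[OF _ \<omega>])
  also have "\<dots> = (if j = fst (snd \<omega>) then c \<omega> else 0)"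
    using finite(2) \<omega> by (cases \<omega>) (auto simp: I_def F_def Omega_iff)
  finally show ?thesis .
qed

lemma coef_synth:
  assumes "0 < s" "0 \<le> \<epsilon>" "\<And>\<omega>. \<omega> \<in> Omega \<Longrightarrow> weighted_abs s c \<omega> \<le> \<epsilon>" and \<omega>: "\<omega> \<in> Omega"
  shows "coef \<phi> \<psi> (synth c) \<omega> = c \<omega>"
proof -
  have "2 powr (- s) < 1" using assms(1) by (simp add: powr_less_one)
  then have "summable (\<lambda>j. level_const * \<epsilon> * (2 powr (- s)) ^ j)"
    by (intro summable_mult summable_geometric) simp
  moreover have "bounded_borel (level_const * \<epsilon> * (2 powr (- s)) ^ j) (synth_level c j)" for j
    using borel_measurable_continuous_onI[OF continuous_on_synth_level] abs_synth_level_le[OF assms(3,2)]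
    by (simp add: bounded_borel_def)
  ultimately have "(\<lambda>j. coef \<phi> \<psi> (synth_level c j) \<omega>) sums coef \<phi> \<psi> (synth c) \<omega>"
    unfolding coef_def synth_def by (intro sums_integral_bounded_borel_mult integrable_wav[OF \<omega>])
  moreover have "(\<lambda>j. coef \<phi> \<psi> (synth_level c j) \<omega>) sums c \<omega>"
    unfolding coef_synth_level[OF \<omega>] by (rule sums_single)
  ultimately show ?thesis by (rule sums_unique2)
qed

theorem ex_synthesis_const:
  assumes s: "0 < s" "s < real m"
  shows "\<exists>S>0. \<forall>c \<epsilon>. 0 \<le> \<epsilon> \<longrightarrow> (\<forall>\<omega>\<in>Omega. weighted_abs s c \<omega> \<le> \<epsilon>) \<longrightarrow>
    (\<exists>h. lip_bound m s (S * \<epsilon>) h \<and> (\<forall>\<omega>\<in>Omega. coef \<phi> \<psi> h \<omega> = c \<omega>))"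
proof (intro exI conjI allI impI)
  show "0 < dyadic_sum_const m s * level_const"
    by (intro mult_pos_pos dyadic_sum_const_pos s level_const_pos)
  fix c :: "nat \<times> nat \<times> (int^'n) \<Rightarrow> real" and \<epsilon> :: real
  assume bounds: "0 \<le> \<epsilon>" "\<forall>\<omega>\<in>Omega. weighted_abs s c \<omega> \<le> \<epsilon>"
  then show "lip_bound m s (dyadic_sum_const m s * level_const * \<epsilon>) (synth c)"
    using lip_bound_synth[OF s] by (simp add: mult.assoc)
  show "\<forall>\<omega>\<in>Omega. coef \<phi> \<psi> (synth c) \<omega> = c \<omega>"
    using coef_synth[OF s(1)] bounds by blast
qed

end

lemma daubechies_imp_wavelet_system:
  fixes \<phi> :: "real^'n \<Rightarrow> real"
  assumes "daubechies L \<phi> \<psi>" "m \<le> L"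
  shows "\<exists>R M. wavelet_system \<phi> \<psi> m L R M"
proof -
  have "Ck_c L (generator \<phi> \<psi> l)" if "l \<le> 2 ^ CARD('n) - 1" for l
    using assms(1) that by (auto simp: daubechies_def generator_def)
  then have "\<exists>R M. \<forall>l\<in>{..2 ^ CARD('n) - 1}. bump m R M (generator \<phi> \<psi> l)"
    by (intro ex_common_bump ex_bump_if_Ck_c[OF _ assms(2)]) auto
  then obtain R M where "\<forall>l\<in>{..2 ^ CARD('n) - 1}. bump m R M (generator \<phi> \<psi> l)" by blast
  then have "wavelet_system \<phi> \<psi> m L R M"
  proof (intro wavelet_system.intro)
    show "vanishing_moments L (generator \<phi> \<psi> l)" if "1 \<le> l" "l \<le> 2 ^ CARD('n) - 1" for l
      using assms(1) that by (simp add: daubechies_def generator_def vanishing_moments_def)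
    show "(LINT x|lborel. wav \<phi> \<psi> \<omega> x * wav \<phi> \<psi> \<omega>' x) = (if \<omega> = \<omega>' then 1 else 0)"
      if "\<omega> \<in> Omega" "\<omega>' \<in> Omega" for \<omega> \<omega>'
      using assms(1) that unfolding daubechies_def by blast
  qed (use assms(2) in auto)
  then show ?thesis by blast
qed

section \<open>The distance formula\<close>

lemma qn_lattice_finite_if_dominated:
  assumes "qn_lattice X" "adm_seq F" "adm_seq G" "X G < \<infinity>"
    and dominated: "\<And>j x. \<bar>F j x\<bar> \<le> c * \<bar>G j x\<bar>" and "0 \<le> c"
  shows "X F < \<infinity>"
proof -
  have "adm_seq (\<lambda>j x. c * G j x)"
    using assms(3) by (auto simp: adm_seq_def intro!: borel_measurable_times)
  moreover have "\<forall>j. AE x in lebesgue. \<bar>F j x\<bar> \<le> \<bar>c * G j x\<bar>"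
    using dominated \<open>0 \<le> c\<close> by (simp add: abs_mult)
  ultimately have "X F \<le> X (\<lambda>j x. c * G j x)" using assms(1,2) unfolding qn_lattice_def by blast
  also have "\<dots> = ennreal \<bar>c\<bar> * X G" using assms(1,3) unfolding qn_lattice_def by blast
  also have "\<dots> < \<infinity>" using assms(4) by (simp add: ennreal_mult_less_top)
  finally show ?thesis .
qed

lemma ennreal_inverse_mult_le_iff:
  assumes "0 < a"
  shows "ennreal (1 / a) * x \<le> y \<longleftrightarrow> x \<le> ennreal a * y"
proof -
  have "ennreal a * ennreal (1 / a) = 1" "ennreal (1 / a) * ennreal a = 1"
    using assms by (simp_all flip: ennreal_mult)
  then have "ennreal a * (ennreal (1 / a) * x) = x" "ennreal (1 / a) * (ennreal a * y) = y"
    by (simp_all flip: mult.assoc)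
  then show ?thesis by (metis mult_left_mono zero_le)
qed

definition diff_order :: "real \<Rightarrow> nat" where
  "diff_order s = nat \<lfloor>s\<rfloor> + 1"

lemma less_diff_order: "s < real (diff_order s)"
  unfolding diff_order_def by linarith

lemma diff_order_le: "0 < s \<Longrightarrow> s < real L \<Longrightarrow> diff_order s \<le> L"
  unfolding diff_order_def by linarith

lemma lip_bound_if_Lambda_norm_le:
  fixes f :: "real^'n \<Rightarrow> real"
  assumes f: "continuous_on UNIV f" and norm: "Lambda_norm s f \<le> ennreal B" and B: "0 \<le> B"
  shows "lip_bound (diff_order s) s B f"
  unfolding lip_bound_def
proof (intro conjI allI impI f)
  fix x
  have "ennreal \<bar>f x\<bar> \<le> sup_norm f" unfolding sup_norm_def by (rule SUP_upper) simp
  also have "\<dots> \<le> ennreal B" using norm by (auto simp: Lambda_norm_def intro: order_trans[rotated])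
  finally show "\<bar>f x\<bar> \<le> B" using B by (simp add: ennreal_le_iff)
next
  fix h x :: "real^'n"
  assume h: "0 < norm h" "norm h \<le> 1"
  let ?d = "\<bar>diffk (diff_order s) h f x\<bar>" and ?y = "norm h"
  have "ennreal (?d / ?y powr s) = ennreal ?d / ennreal (?y powr s)"
    using h by (simp add: divide_ennreal)
  also have "\<dots> \<le> Delta_sup (diff_order s) f x ?y / ennreal (?y powr s)"
    unfolding Delta_sup_def by (intro divide_right_mono_ennreal SUP_upper) simp
  also have "\<dots> \<le> (SUP y\<in>{0<..1}. Delta_sup (diff_order s) f x y / ennreal (y powr s))"
    by (rule SUP_upper) (use h in auto)
  also have "\<dots> \<le> (SUP x. SUP y\<in>{0<..1}. Delta_sup (diff_order s) f x y / ennreal (y powr s))"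
    by (rule SUP_upper) simp
  also have "\<dots> \<le> Lambda_norm s f" by (simp add: Lambda_norm_def diff_order_def)
  also note norm
  finally have "?d / ?y powr s \<le> B" using B by (simp add: ennreal_le_iff)
  then show "?d \<le> B * ?y powr s" using h by (simp add: divide_le_eq)
qed

lemma Lambda_norm_le_if_lip_bound:
  assumes f: "lip_bound (diff_order s) s B f"
  shows "Lambda_norm s f \<le> ennreal (2 * B)"
proof -
  have B: "0 \<le> B" by (rule lip_bound_nonneg[OF f])
  have "sup_norm f \<le> ennreal B"
    unfolding sup_norm_def using f by (intro SUP_least ennreal_leI) (auto simp: lip_bound_def)
  moreover have "(SUP x. SUP y\<in>{0<..1}. Delta_sup (diff_order s) f x y / ennreal (y powr s)) \<le> ennreal B"
  proof (intro SUP_least)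
    fix x and y :: real assume y: "y \<in> {0<..1}"
    have "Delta_sup (diff_order s) f x y \<le> ennreal (B * y powr s)"
      unfolding Delta_sup_def using f y
      by (intro SUP_least ennreal_leI) (auto simp: lip_bound_def)
    then have "Delta_sup (diff_order s) f x y / ennreal (y powr s)
        \<le> ennreal (B * y powr s) / ennreal (y powr s)"
      by (rule divide_right_mono_ennreal)
    also have "\<dots> = ennreal B" using y B by (subst divide_ennreal) auto
    finally show "Delta_sup (diff_order s) f x y / ennreal (y powr s) \<le> ennreal B" .
  qed
  ultimately have "Lambda_norm s f \<le> ennreal B + ennreal B"
    unfolding Lambda_norm_def diff_order_def by (rule add_mono)
  then show ?thesis using B by (simp flip: ennreal_plus)
qed

lemma Lambda_iff_lip_bound: "f \<in> Lambda s \<longleftrightarrow> (\<exists>B. lip_bound (diff_order s) s B f)"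
proof
  assume f: "f \<in> Lambda s"
  then obtain B where "Lambda_norm s f = ennreal B" "0 \<le> B"
    by (cases "Lambda_norm s f") (auto simp: Lambda_def)
  with f show "\<exists>B. lip_bound (diff_order s) s B f"
    by (auto simp: Lambda_def intro!: exI[of _ B] lip_bound_if_Lambda_norm_le)
next
  assume "\<exists>B. lip_bound (diff_order s) s B f"
  then obtain B where f: "lip_bound (diff_order s) s B f" by blast
  then have "continuous_on UNIV f" "bounded (range f)"
    by (auto simp: bounded_iff lip_bound_def)
  moreover have "Lambda_norm s f < \<infinity>"
    using order_le_less_trans[OF Lambda_norm_le_if_lip_bound[OF f]] by simp
  ultimately show "f \<in> Lambda s" by (simp add: Lambda_def)
qed

locale lipschitz_wavelet_characterization =
  fixes \<phi> :: "real^'n \<Rightarrow> real" and \<psi> :: "nat \<Rightarrow> real^'n \<Rightarrow> real" and s A S :: real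
  assumes integrable_wav: "\<omega> \<in> Omega \<Longrightarrow> integrable lborel (wav \<phi> \<psi> \<omega>)"
    and analysis: "lip_bound (diff_order s) s B f \<Longrightarrow> \<omega> \<in> Omega \<Longrightarrow>
      weighted_abs s (coef \<phi> \<psi> f) \<omega> \<le> A * B"
    and synthesis: "0 \<le> \<epsilon> \<Longrightarrow> (\<forall>\<omega>\<in>Omega. weighted_abs s c \<omega> \<le> \<epsilon>) \<Longrightarrow>
      \<exists>h. lip_bound (diff_order s) s (S * \<epsilon>) h \<and> (\<forall>\<omega>\<in>Omega. coef \<phi> \<psi> h \<omega> = c \<omega>)"
    and analysis_const_pos: "0 < A" and synthesis_const_pos: "0 < S"
begin

lemma coef_diff:
  assumes "f \<in> Lambda s" "g \<in> Lambda s" "\<omega> \<in> Omega"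
  shows "coef \<phi> \<psi> (\<lambda>x. f x - g x) \<omega> = coef \<phi> \<psi> f \<omega> - coef \<phi> \<psi> g \<omega>"
proof -
  have "integrable lborel (\<lambda>x. f x * wav \<phi> \<psi> \<omega> x)" if "f \<in> Lambda s" for f
    using that integrable_bounded_borel_mult[OF lip_bound_imp_bounded_borel integrable_wav[OF assms(3)]]
    by (auto simp: Lambda_iff_lip_bound)
  with assms(1,2) show ?thesis by (simp add: coef_def left_diff_distrib)
qed

lemma finite_W0_seq_if_lip_bound_diff:
  assumes X: "qn_lattice X" and f: "f \<in> Lambda s" and g: "g \<in> Lambda_X X s \<phi> \<psi>"
    and close: "lip_bound (diff_order s) s B (\<lambda>x. f x - g x)" and \<epsilon>: "A * B < \<epsilon>"
  shows "X (W0_seq \<phi> \<psi> s f \<epsilon>) < \<infinity>"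
proof (rule qn_lattice_finite_if_dominated[OF X adm_seq_W0_seq adm_seq_wseq])
  show "X (wseq s \<phi> \<psi> g) < \<infinity>" using g by (simp add: Lambda_X_def)
  show "0 \<le> 1 / (\<epsilon> - A * B)" using \<epsilon> by simp
  show "\<bar>W0_seq \<phi> \<psi> s f \<epsilon> j x\<bar> \<le> 1 / (\<epsilon> - A * B) * \<bar>wseq s \<phi> \<psi> g j x\<bar>" for j x
  proof (cases "cube_index j x \<in> W0 \<phi> \<psi> s f \<epsilon> j")
    case True
    then obtain l where l: "l \<in> generator_indices CARD('n) j"
      and large: "\<epsilon> < weighted_abs s (coef \<phi> \<psi> f) (l, j, cube_index j x)"
      by (auto simp: W0_iff)
    let ?\<omega> = "(l, j, cube_index j x)" and ?d = "\<lambda>x. f x - g x"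
    have \<omega>: "?\<omega> \<in> Omega" using l by (simp add: Omega_iff)
    have "g \<in> Lambda s" using g by (simp add: Lambda_X_def)
    then have "\<bar>coef \<phi> \<psi> f ?\<omega>\<bar> \<le> \<bar>coef \<phi> \<psi> ?d ?\<omega>\<bar> + \<bar>coef \<phi> \<psi> g ?\<omega>\<bar>"
      using coef_diff[OF f _ \<omega>] by simp
    then have "weighted_abs s (coef \<phi> \<psi> f) ?\<omega>
        \<le> weighted_abs s (coef \<phi> \<psi> ?d) ?\<omega> + weighted_abs s (coef \<phi> \<psi> g) ?\<omega>"
      unfolding weighted_abs_def distrib_left[symmetric] by (rule mult_left_mono) simp
    then have "\<epsilon> - A * B \<le> weighted_abs s (coef \<phi> \<psi> g) ?\<omega>"
      using large analysis[OF close \<omega>] by linarith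
    also have "\<dots> \<le> wseq s \<phi> \<psi> g j x"
      unfolding wseq_eq
      by (rule member_le_sum[OF l]) (auto simp: weighted_abs_nonneg finite_generator_indices)
    finally show ?thesis using True \<epsilon> by (simp add: W0_seq_eq le_divide_eq)
  qed (use \<epsilon> in \<open>simp add: W0_seq_eq\<close>)
qed

lemma eps_crit_le_Lambda_norm_diff:
  assumes X: "qn_lattice X" and f: "f \<in> Lambda s" and g: "g \<in> Lambda_X X s \<phi> \<psi>"
  shows "eps_crit X s \<phi> \<psi> f \<le> ennreal A * Lambda_norm s (\<lambda>x. f x - g x)"
proof (cases "Lambda_norm s (\<lambda>x. f x - g x)")
  case (real B)
  have "continuous_on UNIV (\<lambda>x. f x - g x)"
    using f g by (intro continuous_on_diff) (auto simp: Lambda_X_def Lambda_def)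
  with real have close: "lip_bound (diff_order s) s B (\<lambda>x. f x - g x)"
    by (intro lip_bound_if_Lambda_norm_le) auto
  have slack: "eps_crit X s \<phi> \<psi> f \<le> ennreal (A * B) + ennreal e" if "0 < e" for e
  proof -
    have "0 \<le> A * B" using real analysis_const_pos by simp
    moreover have "X (W0_seq \<phi> \<psi> s f (A * B + e)) < \<infinity>"
      by (rule finite_W0_seq_if_lip_bound_diff[OF X f g close]) (use that in simp)
    ultimately have "eps_crit X s \<phi> \<psi> f \<le> ennreal (A * B + e)"
      unfolding eps_crit_def using that by (intro Inf_lower CollectI exI[of _ "A * B + e"]) auto
    then show ?thesis using that \<open>0 \<le> A * B\<close> by simp
  qed
  have "eps_crit X s \<phi> \<psi> f \<le> ennreal (A * B)" by (rule ennreal_le_epsilon) (rule slack)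
  then show ?thesis using real analysis_const_pos by (simp add: ennreal_mult)
qed (use analysis_const_pos in \<open>simp add: ennreal_mult_top\<close>)

theorem eps_crit_le_dist_Lambda:
  assumes "qn_lattice X" "f \<in> Lambda s"
  shows "ennreal (1 / A) * eps_crit X s \<phi> \<psi> f \<le> dist_Lambda s f (Lambda_X X s \<phi> \<psi>)"
  unfolding dist_Lambda_def
  by (rule INF_greatest, unfold ennreal_inverse_mult_le_iff[OF analysis_const_pos])
    (auto intro: eps_crit_le_Lambda_norm_diff assms)

lemma wseq_le_W0_seq:
  assumes g: "lip_bound (diff_order s) s B g"
    and zero: "\<And>l k. (l, j, k) \<in> Omega \<Longrightarrow> k \<notin> W0 \<phi> \<psi> s f \<epsilon> j \<Longrightarrow> coef \<phi> \<psi> g (l, j, k) = 0"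
  shows "\<bar>wseq s \<phi> \<psi> g j x\<bar> \<le> 2 ^ CARD('n) * (A * B) * \<bar>W0_seq \<phi> \<psi> s f \<epsilon> j x\<bar>"
proof (cases "cube_index j x \<in> W0 \<phi> \<psi> s f \<epsilon> j")
  case True
  have "0 \<le> A * B" using lip_bound_nonneg[OF g] analysis_const_pos by simp
  have "wseq s \<phi> \<psi> g j x \<le> real (card (generator_indices CARD('n) j)) * (A * B)"
    unfolding wseq_eq by (intro sum_bounded_above analysis[OF g]) (simp add: Omega_iff)
  also have "\<dots> \<le> 2 ^ CARD('n) * (A * B)"
    by (rule mult_right_mono[OF card_generator_indices_le \<open>0 \<le> A * B\<close>])
  finally show ?thesis
    using True by (simp add: W0_seq_eq wseq_eq weighted_abs_nonneg sum_nonneg)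
next
  case False
  then show ?thesis using zero by (simp add: W0_seq_eq wseq_eq weighted_abs_def Omega_iff)
qed

lemma ex_Lambda_X_close:
  assumes X: "qn_lattice X" and f: "f \<in> Lambda s" and \<epsilon>: "0 < \<epsilon>" and W0: "X (W0_seq \<phi> \<psi> s f \<epsilon>) < \<infinity>"
  shows "\<exists>g\<in>Lambda_X X s \<phi> \<psi>. lip_bound (diff_order s) s (S * \<epsilon>) (\<lambda>x. f x - g x)"
proof -
  define c where "c \<omega> = (if snd (snd \<omega>) \<in> W0 \<phi> \<psi> s f \<epsilon> (fst (snd \<omega>)) then 0 else coef \<phi> \<psi> f \<omega>)" for \<omega>
  have "weighted_abs s c \<omega> \<le> \<epsilon>" if "\<omega> \<in> Omega" for \<omega>
    using that \<epsilon> by (cases \<omega>) (auto simp: c_def weighted_abs_def W0_iff Omega_iff not_less)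
  then obtain h where h: "lip_bound (diff_order s) s (S * \<epsilon>) h"
    and coef_h: "\<forall>\<omega>\<in>Omega. coef \<phi> \<psi> h \<omega> = c \<omega>"
    using synthesis[of \<epsilon> c] \<epsilon> by auto
  let ?g = "\<lambda>x. f x - h x"
  obtain B where "lip_bound (diff_order s) s B f" using f by (auto simp: Lambda_iff_lip_bound)
  then have g: "lip_bound (diff_order s) s (B + S * \<epsilon>) ?g" using h by (rule lip_bound_diff)
  have "h \<in> Lambda s" using h by (auto simp: Lambda_iff_lip_bound)
  then have coef_g: "coef \<phi> \<psi> ?g (l, j, k) = 0" if "(l, j, k) \<in> Omega" "k \<notin> W0 \<phi> \<psi> s f \<epsilon> j" for l j k
    using that coef_diff[OF f] coef_h by (simp add: c_def)
  have "X (wseq s \<phi> \<psi> ?g) < \<infinity>"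
  proof (rule qn_lattice_finite_if_dominated[OF X adm_seq_wseq adm_seq_W0_seq W0])
    show "0 \<le> 2 ^ CARD('n) * (A * (B + S * \<epsilon>))"
      using lip_bound_nonneg[OF g] analysis_const_pos by simp
  qed (rule wseq_le_W0_seq[OF g coef_g])
  with g have "?g \<in> Lambda_X X s \<phi> \<psi>" by (auto simp: Lambda_X_def Lambda_iff_lip_bound)
  moreover have "lip_bound (diff_order s) s (S * \<epsilon>) (\<lambda>x. f x - ?g x)" using h by simp
  ultimately show ?thesis by (intro bexI[of _ ?g])
qed

theorem dist_Lambda_le_eps_crit:
  assumes X: "qn_lattice X" and f: "f \<in> Lambda s"
  shows "dist_Lambda s f (Lambda_X X s \<phi> \<psi>) \<le> ennreal (2 * S) * eps_crit X s \<phi> \<psi> f"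
proof -
  have S: "0 < 2 * S" using synthesis_const_pos by simp
  have "dist_Lambda s f (Lambda_X X s \<phi> \<psi>) \<le> ennreal (2 * S) * ennreal \<epsilon>"
    if \<epsilon>: "0 < \<epsilon>" "X (W0_seq \<phi> \<psi> s f \<epsilon>) < \<infinity>" for \<epsilon>
  proof -
    obtain g where g: "g \<in> Lambda_X X s \<phi> \<psi>" "lip_bound (diff_order s) s (S * \<epsilon>) (\<lambda>x. f x - g x)"
      using ex_Lambda_X_close[OF X f \<epsilon>] by blast
    then have "dist_Lambda s f (Lambda_X X s \<phi> \<psi>) \<le> Lambda_norm s (\<lambda>x. f x - g x)"
      unfolding dist_Lambda_def by (intro INF_lower) (auto simp: Lambda_X_def)
    also have "\<dots> \<le> ennreal (2 * (S * \<epsilon>))" by (rule Lambda_norm_le_if_lip_bound[OF g(2)])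
    finally show ?thesis using S \<epsilon> by (simp add: mult.assoc flip: ennreal_mult)
  qed
  then show ?thesis
    unfolding ennreal_inverse_mult_le_iff[OF S, symmetric] eps_crit_def
    by (intro Inf_greatest) (auto simp: ennreal_inverse_mult_le_iff[OF S])
qed

end

theorem mainTheorem3:
  fixes X :: "(nat \<Rightarrow> real^'n \<Rightarrow> real) \<Rightarrow> ennreal"
    and s :: real and L :: nat
    and \<phi> :: "real^'n \<Rightarrow> real" and \<psi> :: "nat \<Rightarrow> real^'n \<Rightarrow> real"
  assumes "qn_lattice X" and "0 < s"
    and "daubechies L \<phi> \<psi>" and "s < real L"
  shows "\<exists>c C. 0 < c \<and> 0 < C \<and>
           (\<forall>f\<in>Lambda s.
              ennreal c * eps_crit X s \<phi> \<psi> f \<le> dist_Lambda s f (Lambda_X X s \<phi> \<psi>) \<and>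
              dist_Lambda s f (Lambda_X X s \<phi> \<psi>) \<le> ennreal C * eps_crit X s \<phi> \<psi> f)"
proof -
  obtain R M where "wavelet_system \<phi> \<psi> (diff_order s) L R M"
    using daubechies_imp_wavelet_system[OF assms(3)] diff_order_le[OF assms(2,4)] by blast
  then interpret W: wavelet_system \<phi> \<psi> "diff_order s" L R M .
  obtain A where "0 < A" and analysis: "\<And>f B \<omega>. lip_bound (diff_order s) s B f \<Longrightarrow> \<omega> \<in> Omega \<Longrightarrow>
      weighted_abs s (coef \<phi> \<psi> f) \<omega> \<le> A * B"
    using W.ex_analysis_const[OF assms(2) less_diff_order] by blast
  obtain S where "0 < S" and synthesis: "\<And>c \<epsilon>. 0 \<le> \<epsilon> \<Longrightarrow> \<forall>\<omega>\<in>Omega. weighted_abs s c \<omega> \<le> \<epsilon> \<Longrightarrow>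
      \<exists>h. lip_bound (diff_order s) s (S * \<epsilon>) h \<and> (\<forall>\<omega>\<in>Omega. coef \<phi> \<psi> h \<omega> = c \<omega>)"
    using W.ex_synthesis_const[OF assms(2) less_diff_order] by blast
  interpret lipschitz_wavelet_characterization \<phi> \<psi> s A S
    using W.integrable_wav analysis synthesis \<open>0 < A\<close> \<open>0 < S\<close> by unfold_locales auto
  have "0 < 1 / A" "0 < 2 * S" using \<open>0 < A\<close> \<open>0 < S\<close> by auto
  then show ?thesis
    using eps_crit_le_dist_Lambda[OF assms(1)] dist_Lambda_le_eps_crit[OF assms(1)] by blast
qed

end
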